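(* Let $\Delta\ge3$ be an integer. Suppose $k>\Delta$ is an integer and $0<\varepsilon<1$ are such that there exists a constant $0<K<1/(\Delta-1)$ with $\theta:=\arcsin(K)\in\big(0,\frac{\pi}{3(\Delta-1+\varepsilon)}\big)$ such that for each $d=0,\dots,\Delta-1$, with $b=\Delta-d$, \[0<\frac{(1+\varepsilon)^2}{(k-b)(1-K)^d-\varepsilon b}\le K.\] Let $G=(V,E)$ be any graph of maximum degree at most $\Delta$ and $(w_e)_{e\in E}$ complex weights such that for each $e\in E$ either (i) $|w_e|\le\varepsilon$, or (ii) $|\arg(w_e)|\le\varepsilon\theta$ and $\varepsilon<|w_e|\le1$. Write $\mathbf{Z}^W_L(G)$ for the restricted partition function with $k$ colours and these weights. Then: (A) For every list $W$ of distinct vertices forming a leaf-independent set in $G$ and every list $L$ of colours with $|L|=|W|$, $\mathbf{Z}^W_L(G)\ne0$. (B) For every list $W=W'u$ of distinct vertices forming a leaf-independent set, and any two colour lists $L'\ell$ and $L'\ell'$ of length $|W|$: (i) the angle between $\mathbf{Z}^{W'u}_{L'\ell}(G)$ and $\mathbf{Z}^{W'u}_{L'\ell'}(G)$ is at most $\theta$; (ii) $\mathbf{Z}^{W'u}_{L'\ell}(G)/\mathbf{Z}^{W'u}_{L'\ell'}(G)\in B(1,K)$. (C) For every list $W=W'u$ of distinct vertices such that $W'$ forms a leaf-independent set in $G$, and every colour list $L'$ of length $|W'|$: let $\mathcal{G}$ and $\mathcal{N}$ be the sets of good and neutral colours for $u$ with respect to $(G,W',L',\varepsilon)$, let $d$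 be the number of free neighbours of $u$ (neighbours not in $W'$) and $b=\Delta-d$. Then (i) $\mathbf{Z}^{W'u}_{L'\ell}(G)\neq0$ for every $\ell\in\mathcal{G}\cup\mathcal{N}$; (ii) for all $\ell,\ell'\in\mathcal{G}\cup\mathcal{N}$ the angle between $\mathbf{Z}^{W'u}_{L'\ell}(G)$ and $\mathbf{Z}^{W'u}_{L'\ell'}(G)$ is at most $(d+b\varepsilon)\theta$; (iii) for all $\ell,j\in\mathcal{G}$, $\mathbf{Z}^{W'u}_{L'\ell}(G)/\mathbf{Z}^{W'u}_{L'j}(G)\in B(1,K)^d$.
   Context: Graphs are simple; $[k]=\{1,\dots,k\}$. For a graph $G=(V,E)$ with complex edge weights $(w_e)$, a list $W=w_1\dots w_m$ of distinct vertices and a list $L=\ell_1\dots\ell_m$ of colours in $[k]$, the restricted partition function is \[\mathbf{Z}^W_L(G)=\sum_{\phi:V\to[k],\ \phi(w_i)=\ell_i\ \forall i}\ \prod_{uv\in E,\ \phi(u)=\phi(v)} w_{uv}.\] $W'u$ and $L'\ell$ denote concatenation of lists. Vertices in $W$ are called fixed (with colour given by $L$); other vertices are free. A set $W\subseteq V$ is leaf-independent if it is an independent set and every vertex in $W$ has degree exactly $1$. Given $\varepsilon>0$, a neighbour $v$ of $u$ is a bad neighbour if $|w_{uv}|\le\varepsilon$. A colour $\ell$ is good for $u$ if no fixed neighbour of $u$ has colour $\ell$; bad if $u$ has at least one fixed bad neighbour coloured $\ell$; neutral if neither good nor bad. Angles between non-zero complex numbers are taken in $[0,\pi]$. $B(a,r)$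 is the open disk of radius $r$ centred at $a$, and $B(a,r)^d=\{b_1\cdots b_d: b_i\in B(a,r)\}$. *)

theory Defs
  imports "HOL-Analysis.Analysis"
begin

definition simple_graph :: "'a set \<Rightarrow> 'a set set \<Rightarrow> bool" where
  "simple_graph V Es \<longleftrightarrow> finite V \<and> (\<forall>e\<in>Es. e \<subseteq> V \<and> card e = 2)"

definition adj :: "'a set set \<Rightarrow> 'a \<Rightarrow> 'a \<Rightarrow> bool" where
  "adj Es u v \<longleftrightarrow> {u, v} \<in> Es"

definition degree :: "'a set \<Rightarrow> 'a set set \<Rightarrow> 'a \<Rightarrow> nat" where
  "degree V Es u = card {v\<in>V. adj Es u v}"

definition max_degree_le :: "'a set \<Rightarrow> 'a set set \<Rightarrow> nat \<Rightarrow> bool" where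
  "max_degree_le V Es D \<longleftrightarrow> (\<forall>u\<in>V. degree V Es u \<le> D)"

definition leaf_independent :: "'a set \<Rightarrow> 'a set set \<Rightarrow> 'a set \<Rightarrow> bool" where
  "leaf_independent V Es W \<longleftrightarrow> W \<subseteq> V \<and> (\<forall>x\<in>W. \<forall>y\<in>W. \<not> adj Es x y)
      \<and> (\<forall>x\<in>W. degree V Es x = 1)"

definition Zr :: "nat \<Rightarrow> 'a set \<Rightarrow> 'a set set \<Rightarrow> ('a set \<Rightarrow> complex)
                  \<Rightarrow> 'a list \<Rightarrow> nat list \<Rightarrow> complex" where
  "Zr k V Es w W L =
     (\<Sum>\<phi> \<in> {\<phi> \<in> V \<rightarrow>\<^sub>E {1..k}. \<forall>i<length W. \<phi> (W ! i) = L ! i}.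
        \<Prod>e \<in> {e \<in> Es. \<exists>c. \<forall>x\<in>e. \<phi> x = c}. w e)"

definition cangle :: "complex \<Rightarrow> complex \<Rightarrow> real" where
  "cangle z1 z2 = \<bar>Arg (z1 / z2)\<bar>"

definition ball_pow :: "complex \<Rightarrow> real \<Rightarrow> nat \<Rightarrow> complex set" where
  "ball_pow a r d = {\<Prod>i<d. b i | b. \<forall>i<d. b i \<in> ball a r}"

definition good_colour :: "'a set set \<Rightarrow> 'a list \<Rightarrow> nat list \<Rightarrow> 'a \<Rightarrow> nat \<Rightarrow> bool" where
  "good_colour Es W L u l \<longleftrightarrow> \<not> (\<exists>i<length W. adj Es u (W ! i) \<and> L ! i = l)"

definition bad_colour :: "'a set set \<Rightarrow> ('a set \<Rightarrow> complex) \<Rightarrow> real \<Rightarrow> 'a list \<Rightarrow> nat list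
                           \<Rightarrow> 'a \<Rightarrow> nat \<Rightarrow> bool" where
  "bad_colour Es w eps W L u l \<longleftrightarrow>
     (\<exists>i<length W. adj Es u (W ! i) \<and> cmod (w {u, W ! i}) \<le> eps \<and> L ! i = l)"

definition neutral_colour :: "'a set set \<Rightarrow> ('a set \<Rightarrow> complex) \<Rightarrow> real \<Rightarrow> 'a list \<Rightarrow> nat list
                           \<Rightarrow> 'a \<Rightarrow> nat \<Rightarrow> bool" where
  "neutral_colour Es w eps W L u l \<longleftrightarrow>
     \<not> good_colour Es W L u l \<and> \<not> bad_colour Es w eps W L u l"

end

theory Submission
  imports Defs
begin

text \<open>Only the free vertices are kept; each fixed neighbour of a free vertex \<open>x\<close> becomes a pin
  (weight, colour) at \<open>x\<close>. By induction on the set \<open>F\<close> of free vertices, the partition function is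
  nonzero, and recolouring a single pin multiplies it by a factor in \<open>B(1, K)\<close>. For the step, pick
  \<open>v\<close> in \<open>F\<close> and expand over the colour \<open>c\<close> of \<open>v\<close>: the partition function is the sum of
  \<open>p c * X c\<close>, where \<open>p c\<close> collects the pins at \<open>v\<close> and \<open>X c\<close> is the partition function on
  \<open>F - {v}\<close> with a pin of colour \<open>c\<close> at each of the \<open>d\<close> neighbours of \<open>v\<close>. Recolouring these pins
  one at a time gives \<open>X c / X j \<in> B(1, K)\<^sup>d\<close>. Elements of \<open>B(1, K)\<^sup>d\<close> have real part at least
  \<open>(1 - K)\<^sup>d\<close> when \<open>d * K \<le> 1\<close>, so after division by the largest \<open>X c\<close> the sum has modulus at
  least \<open>(k - b) (1 - K)\<^sup>d - eps * b\<close>, whereas recolouring a pin at \<open>v\<close> changes it by at most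
  \<open>(1 + eps)\<^sup>2\<close>. Since fixing a vertex introduces pins rather than split copies of the vertex, no
  new vertices are ever needed.\<close>

section \<open>Products of elements of a disk around 1\<close>

lemma abs_Arg_mult_le: "\<bar>Arg (z * w)\<bar> \<le> \<bar>Arg z\<bar> + \<bar>Arg w\<bar>"
proof (cases "z = 0 \<or> w = 0")
  case True
  then show ?thesis by (auto simp: Arg_zero)
next
  case False
  then show ?thesis
    using Arg_bounded[of z] Arg_bounded[of w] by (auto simp: Arg_times')
qed

lemma abs_Arg_inverse: "\<bar>Arg (inverse z)\<bar> = \<bar>Arg z\<bar>"
  by (simp add: Arg_inverse)

lemma abs_Arg_prod_le: "\<bar>Arg (\<Prod>i<n. b i)\<bar> \<le> (\<Sum>i<n. \<bar>Arg (b i)\<bar>)" for n :: nat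
proof (induction n)
  case (Suc n)
  then show ?case
    using abs_Arg_mult_le[of "\<Prod>i<n. b i" "b n"] by simp
qed simp

lemma prod_eq_rcis: "(\<Prod>i\<in>S. b i) = rcis (\<Prod>i\<in>S. cmod (b i)) (\<Sum>i\<in>S. Arg (b i))"
proof (induction S rule: infinite_finite_induct)
  case (insert x F)
  then show ?case
    by (simp add: rcis_mult[symmetric] rcis_cmod_Arg)
qed (auto simp: rcis_def)

lemma Re_eq_cmod_cos_Arg: "Re z = cmod z * cos (Arg z)"
  by (metis Re_rcis rcis_cmod_Arg)

text \<open>The tangents from 0 to the circle of radius \<open>K\<close> about 1 make the angle
  \<open>arcsin K\<close> with the real axis; algebraically,
  \<open>\<bar>Im b\<bar> \<le> K * cmod b\<close>. The positive real part keeps the argument below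
  pi/2, where \<open>arcsin\<close> inverts the sine.\<close>

lemma abs_Arg_le_arcsin:
  assumes "b \<in> ball 1 K" "0 < K" "K < 1"
  shows "\<bar>Arg b\<bar> \<le> arcsin K"
proof -
  obtain x y where b: "b = Complex x y" by (cases b)
  have norm_lt: "cmod (b - 1) < K"
    using assms(1) by (simp add: dist_norm norm_minus_commute)
  then have "(cmod (b - 1))\<^sup>2 < K\<^sup>2"
    by (intro power_strict_mono) auto
  then have lt: "(x - 1)\<^sup>2 + y\<^sup>2 < K\<^sup>2"
    by (simp add: b cmod_power2)
  have "1 - Re b \<le> cmod (1 - b)"
    using complex_Re_le_cmod[of "1 - b"] by simp
  then have Re: "Re b > 0"
    using norm_lt assms by (simp add: norm_minus_commute)
  then have nz: "b \<noteq> 0" by auto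
  have "y\<^sup>2 \<le> ((x - 1)\<^sup>2 + y\<^sup>2) * (x\<^sup>2 + y\<^sup>2)"
  proof -
    \<comment> \<open>Lagrange's identity for the plane vectors \<open>b\<close> and
      \<open>b - 1\<close>: their cross product is \<open>y\<close> up to sign, and the right-hand
      side is the square of their dot product.\<close>
    have "((x - 1)\<^sup>2 + y\<^sup>2) * (x\<^sup>2 + y\<^sup>2) - y\<^sup>2 = (x * (x - 1) + y\<^sup>2)\<^sup>2"
      by (simp add: power2_eq_square algebra_simps)
    then show ?thesis
      using zero_le_power2[of "x * (x - 1) + y\<^sup>2"] by linarith
  qed
  also have "\<dots> \<le> K\<^sup>2 * (x\<^sup>2 + y\<^sup>2)"
    using lt by (intro mult_right_mono) auto
  finally have "(Im b)\<^sup>2 \<le> (K * cmod b)\<^sup>2"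
    by (simp add: b power_mult_distrib cmod_power2)
  then have "\<bar>Im b\<bar> \<le> K * cmod b"
    using assms by (simp add: abs_le_square_iff[symmetric] abs_mult)
  then have "\<bar>sin (Arg b)\<bar> \<le> K"
    using nz by (simp add: sin_Arg field_simps)
  then have s: "sin \<bar>Arg b\<bar> \<le> K"
    by (auto simp: abs_if split: if_splits)
  have a: "\<bar>Arg b\<bar> < pi / 2"
    using Re Arg_Re_pos by blast
  then have "\<bar>Arg b\<bar> = arcsin (sin \<bar>Arg b\<bar>)"
    by (intro arcsin_sin[symmetric]) auto
  also have "\<dots> \<le> arcsin K"
    using s assms by (intro arcsin_le_arcsin) (auto intro: sin_ge_minus_one)
  finally show ?thesis .
qed

section \<open>Lower bounds for the real part of a product\<close>

lemma has_real_derivative_Re_circle_power: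
  fixes r :: real
  shows "((\<lambda>\<psi>. Re ((1 - of_real r * cis \<psi>) ^ Suc m)) has_real_derivative
      Suc m * r * Im ((1 - of_real r * cis \<psi>) ^ m * cis \<psi>)) (at \<psi>)"
proof -
  let ?D = "of_nat (Suc m) * (- (of_real r * (exp (\<i> * of_real \<psi>) * \<i>))) 
              * (1 - of_real r * exp (\<i> * of_real \<psi>)) ^ m"
  have "((\<lambda>z. (1 - of_real r * exp (\<i> * z)) ^ Suc m) has_field_derivative ?D) (at (of_real \<psi>))"
    by (rule derivative_eq_intros refl | simp)+
  from has_field_derivative_Re[OF has_vector_derivative_real_field[OF this]]
  have "((\<lambda>x. Re ((1 - of_real r * exp (\<i> * of_real x)) ^ Suc m)) has_real_derivative Re ?D) (at \<psi>)"
    by simp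
  moreover have "Re ?D = Suc m * r * Im ((1 - of_real r * cis \<psi>) ^ m * cis \<psi>)"
  proof -
    have "?D = - (\<i> * (of_real (Suc m * r) * ((1 - of_real r * cis \<psi>) ^ m * cis \<psi>)))"
      by (simp add: cis_conv_exp algebra_simps)
    then have "Re ?D = Im (of_real (Suc m * r) * ((1 - of_real r * cis \<psi>) ^ m * cis \<psi>))"
      by (simp only: uminus_complex.sel Re_i_times minus_minus)
    then show ?thesis
      by (simp only: Im_complex_of_real Re_complex_of_real times_complex.sel mult_zero_left add_0_right)
  qed
  ultimately show ?thesis
    by (simp add: cis_conv_exp)
qed

text \<open>On the upper half of the circle the derivative of the real part is a positive multiple of
  \<open>sin (\<psi> + m * Arg (1 - r cis \<psi>))\<close>, and \<open>Arg (1 - r cis \<psi>) \<ge> - r \<psi> / (1 - r)\<close>.\<close>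

lemma Re_circle_power_ge:
  assumes "0 \<le> r" "real d * r \<le> 1" "r < 1" "0 \<le> \<psi>" "\<psi> \<le> pi"
  shows "(1 - r) ^ d \<le> Re ((1 - of_real r * cis \<psi>) ^ d)"
proof (cases d)
  case (Suc m)
  have deriv_nonneg: "0 \<le> Suc m * r * Im ((1 - of_real r * cis t) ^ m * cis t)"
    if t: "0 \<le> t" "t \<le> \<psi>" for t
  proof -
    define z where "z = 1 - of_real r * cis t"
    have st: "0 \<le> sin t" "sin t \<le> t"
      using t assms by (auto intro: sin_ge_zero sin_x_le_x)
    have "r * cos t \<le> r"
      using assms by (simp add: mult_left_le)
    then have Re: "Re z \<ge> 1 - r"
      by (simp add: z_def)
    then have Rp: "Re z > 0" using assms by simp
    then have z0: "z \<noteq> 0" by auto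
    have a: "\<bar>Arg z\<bar> < pi / 2"
      using Rp Arg_Re_pos by blast
    have "tan (Arg z) = Im z / Re z"
      using z0 by (simp add: tan_def sin_Arg cos_Arg)
    then have "\<bar>Arg z\<bar> \<le> \<bar>Im z / Re z\<bar>"
      using abs_tan_ge[OF a] by simp
    also have "\<dots> = r * sin t / Re z"
      using Rp st assms by (simp add: z_def abs_mult)
    also have "\<dots> \<le> r * t / (1 - r)"
      using st assms Re Rp t by (intro frac_le mult_left_mono mult_nonneg_nonneg) auto
    finally have "m * \<bar>Arg z\<bar> \<le> m * (r * t / (1 - r))"
      by (intro mult_left_mono) auto
    also have "\<dots> = (m * r / (1 - r)) * t"
      by simp
    \<comment> \<open>With \<open>d = m + 1\<close>, the hypothesis \<open>d * r \<le> 1\<close>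
      says \<open>m * r \<le> 1 - r\<close>.\<close>
    also have "\<dots> \<le> 1 * t"
      using assms t Suc by (intro mult_right_mono) (auto simp: field_simps)
    finally have mt: "m * \<bar>Arg z\<bar> \<le> t" by simp
    have "Im z \<le> 0"
      using st assms by (simp add: z_def)
    then have "Arg z \<le> 0"
      using Arg_pos_iff[of z] Rp by linarith
    then have "m * Arg z \<le> 0" "m * \<bar>Arg z\<bar> = - (m * Arg z)"
      by (auto simp: mult_nonneg_nonpos)
    then have "0 \<le> m * Arg z + t" "m * Arg z + t \<le> pi"
      using mt t assms by linarith+
    then have "0 \<le> sin (m * Arg z + t)"
      by (rule sin_ge_zero)
    moreover have "z ^ m = rcis (cmod z ^ m) (m * Arg z)"
      by (metis DeMoivre2 rcis_cmod_Arg)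
    then have "z ^ m * cis t = rcis (cmod z ^ m) (m * Arg z + t)"
      by (simp add: rcis_def cis_mult mult.assoc)
    ultimately show ?thesis
      using assms unfolding z_def[symmetric] by simp
  qed
  have "Re ((1 - of_real r * cis 0) ^ Suc m) \<le> Re ((1 - of_real r * cis \<psi>) ^ Suc m)"
    by (rule DERIV_nonneg_imp_nondecreasing[OF assms(4)])
       (intro exI conjI, rule has_real_derivative_Re_circle_power, rule deriv_nonneg)
  moreover have "Re ((1 - of_real r * cis 0) ^ Suc m) = (1 - r) ^ Suc m"
    by (metis Re_complex_of_real cis_zero mult.right_neutral of_real_1 of_real_diff of_real_power)
  ultimately show ?thesis
    using Suc by simp
qed simp

text \<open>Every \<open>b\<close> lies on a circle of some radius \<open>\<rho> \<le> r\<close>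
  about 1. Conjugation keeps the real part of the power and allows the angle to be taken in
  \<open>[0, pi]\<close>.\<close>

lemma Re_power_ge:
  assumes "cmod (b - 1) \<le> r" "real d * r \<le> 1" "r < 1"
  shows "(1 - r) ^ d \<le> Re (b ^ d)"
proof -
  define \<rho> where "\<rho> = cmod (1 - b)"
  define \<psi> where "\<psi> = Arg (1 - b)"
  have \<rho>: "0 \<le> \<rho>" "\<rho> \<le> r" 
    using assms by (auto simp: \<rho>_def norm_minus_commute)
  have d\<rho>: "real d * \<rho> \<le> 1"
    using mult_left_mono[OF \<rho>(2), of "real d"] assms by simp
  have b: "b = 1 - of_real \<rho> * cis \<psi>"
    using rcis_cmod_Arg[of "1 - b"] by (simp add: \<rho>_def \<psi>_def rcis_def)
  have "Re (b ^ d) = Re ((1 - of_real \<rho> * cis \<bar>\<psi>\<bar>) ^ d)"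
  proof (cases "\<psi> \<ge> 0")
    case False
    then have "1 - of_real \<rho> * cis \<bar>\<psi>\<bar> = cnj b"
      by (simp add: b cis_cnj)
    then show ?thesis
      by (metis complex_cnj_power complex_cnj(1) complex_cnj_cnj cnj.simps(1))
  qed (simp add: b)
  moreover have "(1 - \<rho>) ^ d \<le> Re ((1 - of_real \<rho> * cis \<bar>\<psi>\<bar>) ^ d)"
    using \<rho> d\<rho> assms Arg_bounded[of "1 - b"]
    by (intro Re_circle_power_ge) (auto simp: \<psi>_def)
  moreover have "(1 - r) ^ d \<le> (1 - \<rho>) ^ d"
    using \<rho> assms by (intro power_mono) auto
  ultimately show ?thesis by linarith
qed

lemma concave_on_ln_cos: "concave_on {- (pi / 2)<..<pi / 2} (\<lambda>x. ln (cos x))"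
proof (rule f''_le0_imp_concave)
  fix x :: real
  assume "x \<in> {- (pi / 2)<..<pi / 2}"
  then have c: "cos x > 0"
    by (intro cos_gt_zero_pi) auto
  show "((\<lambda>x. ln (cos x)) has_real_derivative - tan x) (at x)"
    using c by (auto intro!: derivative_eq_intros simp: tan_def field_simps)
  show "((\<lambda>x. - tan x) has_real_derivative - inverse ((cos x)\<^sup>2)) (at x)"
    using c by (auto intro!: derivative_eq_intros)
qed auto

text \<open>Jensen's inequality for the concave function \<open>ln (cos x)\<close> at the points
  \<open>d * \<alpha> i\<close> with equal weights \<open>1 / d\<close>; their mean is the sum of
  the \<open>\<alpha> i\<close>.\<close>

lemma prod_cos_le_cos_mean_power:
  fixes \<alpha> :: "nat \<Rightarrow> real"
  assumes "d > 0" and \<alpha>: "\<And>i. i < d \<Longrightarrow> \<bar>\<alpha> i\<bar> < pi / (2 * real d)"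
  shows "(\<Prod>i<d. cos (d * \<alpha> i)) \<le> cos (\<Sum>i<d. \<alpha> i) ^ d"
proof -
  have in_range: "d * \<alpha> i \<in> {- (pi / 2)<..<pi / 2}" if "i < d" for i
  proof -
    have "\<bar>d * \<alpha> i\<bar> < pi / 2"
      using \<alpha>[OF that] assms(1) by (simp add: abs_mult field_simps)
    then show ?thesis by (auto simp: abs_less_iff)
  qed
  then have pos: "cos (d * \<alpha> i) > 0" if "i < d" for i
    using that by (intro cos_gt_zero_pi) fastforce+
  have "\<bar>\<Sum>i<d. \<alpha> i\<bar> < (\<Sum>i<d. pi / (2 * real d))"
    using assms by (intro order.strict_trans1[OF sum_abs] sum_strict_mono) auto
  then have "\<bar>\<Sum>i<d. \<alpha> i\<bar> < pi / 2"
    using assms by simp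
  then have cpos: "cos (\<Sum>i<d. \<alpha> i) > 0"
    by (intro cos_gt_zero_pi) auto
  have "(\<Sum>i<d. (1 / d) * ln (cos (d * \<alpha> i))) \<le> ln (cos (\<Sum>i<d. (1 / d) *\<^sub>R (d * \<alpha> i)))"
    using assms in_range by (intro concave_on_sum[OF _ _ concave_on_ln_cos]) auto
  also have "(\<Sum>i<d. (1 / d) *\<^sub>R (d * \<alpha> i)) = (\<Sum>i<d. \<alpha> i)"
    using assms by simp
  finally have "(\<Sum>i<d. ln (cos (d * \<alpha> i))) \<le> d * ln (cos (\<Sum>i<d. \<alpha> i))"
    using assms by (simp add: sum_divide_distrib[symmetric] field_simps)
  then have "ln (\<Prod>i<d. cos (d * \<alpha> i)) \<le> ln (cos (\<Sum>i<d. \<alpha> i) ^ d)"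
    using pos[THEN less_imp_neq, symmetric] cpos by (subst ln_prod) (auto simp: ln_realpow)
  then show ?thesis
    using pos cpos by (subst (asm) ln_le_cancel_iff) (auto intro: prod_pos)
qed

text \<open>Log-concavity of the cosine reduces a product of \<open>d\<close> different factors to \<open>d\<close>-th powers of
  the individual factors.\<close>

lemma Re_prod_ball_ge:
  fixes b :: "nat \<Rightarrow> complex"
  assumes b: "\<And>i. i < d \<Longrightarrow> cmod (b i - 1) \<le> r"
    and r: "real d * r \<le> 1" "r < 1"
    and arg: "\<And>i. i < d \<Longrightarrow> \<bar>Arg (b i)\<bar> < pi / (2 * real d)"
  shows "(1 - r) ^ d \<le> Re (\<Prod>i<d. b i)"
proof (cases "d = 0")
  case False
  then have d: "d > 0" by simp
  have "\<bar>\<Sum>i<d. Arg (b i)\<bar> < (\<Sum>i<d. pi / (2 * real d))"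
    using arg d by (intro order.strict_trans1[OF sum_abs] sum_strict_mono) auto
  then have "\<bar>\<Sum>i<d. Arg (b i)\<bar> < pi / 2"
    using d by simp
  then have cpos: "cos (\<Sum>i<d. Arg (b i)) > 0"
    by (intro cos_gt_zero_pi) auto
  have Re: "Re (\<Prod>i<d. b i) = (\<Prod>i<d. cmod (b i)) * cos (\<Sum>i<d. Arg (b i))"
    by (subst prod_eq_rcis) simp
  have "((1 - r) ^ d) ^ d = (\<Prod>i<d. (1 - r) ^ d)"
    by simp
  also have "\<dots> \<le> (\<Prod>i<d. Re (b i ^ d))"
    using b r by (intro prod_mono) (auto intro: Re_power_ge)
  also have "\<dots> = (\<Prod>i<d. cmod (b i) ^ d * cos (d * Arg (b i)))"
  proof (rule prod.cong[OF refl])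
    fix i
    show "Re (b i ^ d) = cmod (b i) ^ d * cos (d * Arg (b i))"
      by (subst rcis_cmod_Arg[of "b i", symmetric]) (simp only: DeMoivre2 Re_rcis)
  qed
  also have "\<dots> = (\<Prod>i<d. cmod (b i)) ^ d * (\<Prod>i<d. cos (d * Arg (b i)))"
    by (simp add: prod.distrib prod_power_distrib)
  also have "\<dots> \<le> (\<Prod>i<d. cmod (b i)) ^ d * cos (\<Sum>i<d. Arg (b i)) ^ d"
    using d arg by (intro mult_left_mono prod_cos_le_cos_mean_power) (auto intro!: zero_le_power prod_nonneg)
  also have "\<dots> = Re (\<Prod>i<d. b i) ^ d"
    by (simp add: Re power_mult_distrib)
  finally have "((1 - r) ^ d) ^ d \<le> Re (\<Prod>i<d. b i) ^ d" .
  moreover have "0 \<le> Re (\<Prod>i<d. b i)"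
    using cpos by (simp add: Re prod_nonneg)
  ultimately show ?thesis
    using d r by (subst (asm) power_mono_iff) auto
qed simp

text \<open>Strictness comes from the disk being open: among finitely many factors the largest
  distance \<open>r\<close> to 1 is below \<open>K\<close>, and \<open>(1 - K)^d < (1 - r)^d\<close>
  for \<open>d > 0\<close>.\<close>

lemma Re_ball_pow_gt:
  assumes z: "z \<in> ball_pow 1 K d" and "d > 0" "0 < K" "K < 1" "real d * K \<le> 1"
    and arg: "real d * arcsin K < pi / 2"
  shows "(1 - K) ^ d < Re z"
proof -
  obtain b where zb: "z = (\<Prod>i<d. b i)" and b: "\<And>i. i < d \<Longrightarrow> b i \<in> ball 1 K"
    using z by (auto simp: ball_pow_def)
  define r where "r = Max ((\<lambda>i. cmod (b i - 1)) ` {..<d})"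
  have r: "cmod (b i - 1) \<le> r" if "i < d" for i
    using that by (auto simp: r_def)
  have "r \<in> (\<lambda>i. cmod (b i - 1)) ` {..<d}"
    unfolding r_def using assms by (intro Max_in) auto
  then have rK: "r < K" "0 \<le> r"
    using b by (auto simp: dist_norm norm_minus_commute)
  have "real d * r \<le> 1"
    using mult_left_mono[of r K "real d"] rK assms by linarith
  moreover have "\<bar>Arg (b i)\<bar> < pi / (2 * real d)" if "i < d" for i
  proof -
    have "\<bar>Arg (b i)\<bar> \<le> arcsin K"
      using b[OF that] assms by (intro abs_Arg_le_arcsin) auto
    also have "\<dots> < pi / (2 * real d)"
      using arg \<open>d > 0\<close> by (simp add: field_simps)
    finally show ?thesis .
  qed
  ultimately have "(1 - r) ^ d \<le> Re z"
    unfolding zb using r rK assms by (intro Re_prod_ball_ge) auto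
  moreover have "(1 - K) ^ d < (1 - r) ^ d"
    using rK assms by (intro power_strict_mono) auto
  ultimately show ?thesis by simp
qed

lemma abs_Arg_ball_pow_le:
  assumes "z \<in> ball_pow 1 K d" "0 < K" "K < 1"
  shows "\<bar>Arg z\<bar> \<le> real d * arcsin K"
proof -
  obtain b where zb: "z = (\<Prod>i<d. b i)" and b: "\<And>i. i < d \<Longrightarrow> b i \<in> ball 1 K"
    using assms(1) by (auto simp: ball_pow_def)
  have "\<bar>Arg z\<bar> \<le> (\<Sum>i<d. \<bar>Arg (b i)\<bar>)"
    unfolding zb by (rule abs_Arg_prod_le)
  also have "\<dots> \<le> (\<Sum>i<d. arcsin K)"
    using b assms by (intro sum_mono abs_Arg_le_arcsin) auto
  finally show ?thesis by simp
qed

lemma ball_pow_Suc_I: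
  assumes "x \<in> ball_pow a r d" "y \<in> ball a r"
  shows "x * y \<in> ball_pow a r (Suc d)"
proof -
  obtain b where b: "x = (\<Prod>i<d. b i)" "\<And>i. i < d \<Longrightarrow> b i \<in> ball a r"
    using assms(1) by (auto simp: ball_pow_def)
  have "x * y = (\<Prod>i<Suc d. (b(d := y)) i)"
    by (simp add: b(1))
  moreover have "\<forall>i<Suc d. (b(d := y)) i \<in> ball a r"
    using b assms by (auto simp: less_Suc_eq)
  ultimately show ?thesis
    unfolding ball_pow_def by blast
qed

lemma ball_pow_0 [simp]: "ball_pow a r 0 = {1}"
  by (auto simp: ball_pow_def)

text \<open>In a triangle with angle at most 60 degrees at 0, the opposite side is at most the
  longer of the other two. After scaling \<open>y\<close> to 1 this is the law of cosines.\<close>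

lemma cmod_diff_le_of_Arg_le:
  assumes "\<bar>Arg (x / y)\<bar> \<le> pi / 3" "y \<noteq> 0" "cmod x \<le> M" "cmod y \<le> M"
  shows "cmod (x - y) \<le> M"
proof -
  define z where "z = x / y"
  have "cos (pi / 3) \<le> cos \<bar>Arg z\<bar>"
    using assms by (intro cos_monotone_0_pi_le) (auto simp: z_def)
  then have "cmod z * (1 / 2) \<le> cmod z * cos (Arg z)"
    by (intro mult_left_mono) (auto simp: cos_60)
  then have Re: "cmod z / 2 \<le> Re z"
    by (simp add: Re_eq_cmod_cos_Arg[symmetric])
  have "(cmod (z - 1))\<^sup>2 = (cmod z)\<^sup>2 - 2 * Re z + 1"
    unfolding cmod_power2 by (simp add: power2_eq_square algebra_simps)
  also have "\<dots> \<le> (cmod z)\<^sup>2 - cmod z + 1"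
    using Re by simp
  also have "\<dots> \<le> (max (cmod z) 1)\<^sup>2"
  proof (cases "cmod z \<le> 1")
    case True
    then have "cmod z * cmod z \<le> cmod z * 1"
      by (intro mult_left_mono) auto
    then show ?thesis using True by (simp add: power2_eq_square max_def)
  qed (auto simp: max_def)
  finally have "cmod (z - 1) \<le> max (cmod z) 1"
    by (rule power2_le_imp_le) auto
  then have "cmod (z - 1) * cmod y \<le> max (cmod z) 1 * cmod y"
    by (intro mult_right_mono) auto
  also have "\<dots> \<le> M"
    using assms by (auto simp: z_def max_def norm_divide)
  also have "cmod (z - 1) * cmod y = cmod (x - y)"
    using assms by (simp add: z_def norm_mult[symmetric] left_diff_distrib)
  finally show ?thesis .
qed

section \<open>Pinned partition functions\<close>

definition pin_weight :: "(complex \<times> nat) list \<Rightarrow> nat \<Rightarrow> complex" where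
  "pin_weight p c = (\<Prod>q\<leftarrow>p. if snd q = c then fst q else 1)"

lemma pin_weight_Nil [simp]: "pin_weight [] c = 1"
  by (simp add: pin_weight_def)

lemma pin_weight_Cons [simp]:
  "pin_weight (q # p) c = (if snd q = c then fst q else 1) * pin_weight p c"
  by (simp add: pin_weight_def)

lemma pin_weight_append [simp]: "pin_weight (p @ q) c = pin_weight p c * pin_weight q c"
  by (simp add: pin_weight_def)

lemma pin_weight_eq_1: "c \<notin> snd ` set p \<Longrightarrow> pin_weight p c = 1"
  by (induction p) auto

text \<open>The set \<open>S\<close> selects which neighbours of \<open>v\<close> receive the new
  pin, so that they can be handled one at a time; fixing \<open>v\<close> outright takes
  \<open>S = UNIV\<close>.\<close>

definition pinned :: "'a set set \<Rightarrow> ('a set \<Rightarrow> complex) \<Rightarrow> ('a \<Rightarrow> (complex \<times> nat) list) \<Rightarrow>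
    'a set \<Rightarrow> 'a \<Rightarrow> nat \<Rightarrow> 'a \<Rightarrow> (complex \<times> nat) list" where
  "pinned Es w P S v c x = P x @ (if x \<in> S \<and> adj Es v x then [(w {v, x}, c)] else [])"

definition colouring_weight :: "'a set set \<Rightarrow> ('a set \<Rightarrow> complex) \<Rightarrow> 'a set \<Rightarrow>
    ('a \<Rightarrow> (complex \<times> nat) list) \<Rightarrow> ('a \<Rightarrow> nat) \<Rightarrow> complex" where
  "colouring_weight Es w F P \<phi> =
     (\<Prod>e \<in> {e \<in> Es. e \<subseteq> F \<and> (\<exists>c. \<forall>x\<in>e. \<phi> x = c)}. w e) * (\<Prod>x\<in>F. pin_weight (P x) (\<phi> x))"

definition pinned_sum :: "nat \<Rightarrow> 'a set set \<Rightarrow> ('a set \<Rightarrow> complex) \<Rightarrow> 'a set \<Rightarrow>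
    ('a \<Rightarrow> (complex \<times> nat) list) \<Rightarrow> 'a list \<Rightarrow> nat list \<Rightarrow> complex" where
  "pinned_sum k Es w F P W L =
     (\<Sum>\<phi> \<in> {\<phi> \<in> F \<rightarrow>\<^sub>E {1..k}. \<forall>i<length W. \<phi> (W ! i) = L ! i}. colouring_weight Es w F P \<phi>)"

lemma Zr_eq_pinned_sum:
  assumes "simple_graph V Es"
  shows "Zr k V Es w W L = pinned_sum k Es w V (\<lambda>_. []) W L"
proof -
  have "{e \<in> Es. e \<subseteq> V \<and> (\<exists>c. \<forall>x\<in>e. \<phi> x = c)} = {e \<in> Es. \<exists>c. \<forall>x\<in>e. \<phi> x = c}" for \<phi> :: "'a \<Rightarrow> nat"
    using assms by (auto simp: simple_graph_def)
  then show ?thesis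
    by (simp add: Zr_def pinned_sum_def colouring_weight_def)
qed

lemma pinned_sum_cong:
  assumes "\<And>x. x \<in> F \<Longrightarrow> P x = Q x"
  shows "pinned_sum k Es w F P W L = pinned_sum k Es w F Q W L"
  using assms by (simp add: pinned_sum_def colouring_weight_def cong: prod.cong)

lemma finite_edges: "simple_graph V Es \<Longrightarrow> finite Es"
  by (rule finite_subset[of _ "Pow V"]) (auto simp: simple_graph_def)

lemma adj_commute: "adj Es u v \<longleftrightarrow> adj Es v u"
  by (simp add: adj_def insert_commute)

text \<open>A monochromatic edge inside \<open>F\<close> either avoids \<open>v\<close> or joins
  \<open>v\<close> to some \<open>x\<close> coloured \<open>c\<close>. In the second case its weight
  is supplied by the new pin at \<open>x\<close>.\<close>

lemma colouring_weight_pin: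
  assumes G: "simple_graph V Es" and F: "F \<subseteq> V" and v: "v \<in> F"
  shows "colouring_weight Es w F P (\<phi>(v := c)) =
    pin_weight (P v) c * colouring_weight Es w (F - {v}) (pinned Es w P UNIV v c) \<phi>"
proof -
  let ?\<psi> = "\<phi>(v := c)"
  let ?N = "{x \<in> F - {v}. adj Es v x \<and> \<phi> x = c}"
  have fin: "finite Es" "finite F"
    using finite_edges[OF G] G F by (auto intro: finite_subset simp: simple_graph_def)
  have "{e \<in> Es. e \<subseteq> F \<and> (\<exists>c. \<forall>x\<in>e. ?\<psi> x = c)} =
      {e \<in> Es. e \<subseteq> F - {v} \<and> (\<exists>c. \<forall>x\<in>e. \<phi> x = c)} \<union> (\<lambda>x. {v, x}) ` ?N" (is "?A = ?B \<union> ?C")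
  proof (intro equalityI subsetI)
    fix e
    assume e: "e \<in> ?A"
    show "e \<in> ?B \<union> ?C"
    proof (cases "v \<in> e")
      case True
      have "card e = 2"
        using e G by (auto simp: simple_graph_def)
      then obtain x where "e = {v, x}" "x \<noteq> v"
        using True by (auto simp: card_2_iff)
      then show ?thesis
        using e by (auto simp: adj_def)
    next
      case False
      then have "\<And>x. x \<in> e \<Longrightarrow> ?\<psi> x = \<phi> x" by auto
      then show ?thesis
        using e False by auto
    qed
  next
    fix e
    assume "e \<in> ?B \<union> ?C"
    then show "e \<in> ?A"
      using v by (auto simp: adj_def) 
  qed
  moreover have "?B \<inter> ?C = {}"
    by auto
  moreover have "inj_on (\<lambda>x. {v, x}) ?N"
    by (auto simp: inj_on_def doubleton_eq_iff)
  ultimately have edges: "(\<Prod>e \<in> ?A. w e) = (\<Prod>e \<in> ?B. w e) * (\<Prod>x \<in> ?N. w {v, x})"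
    using fin by (simp add: prod.union_disjoint prod.reindex)
  have "(\<Prod>x\<in>F. pin_weight (P x) (?\<psi> x)) =
      pin_weight (P v) c * (\<Prod>x\<in>F - {v}. pin_weight (P x) (\<phi> x))"
    using fin v by (subst prod.remove[of _ v]) (auto intro!: prod.cong)
  moreover have "(\<Prod>x\<in>F - {v}. pin_weight (pinned Es w P UNIV v c x) (\<phi> x)) =
      (\<Prod>x\<in>F - {v}. pin_weight (P x) (\<phi> x)) * (\<Prod>x \<in> ?N. w {v, x})"
  proof -
    have "(\<Prod>x\<in>F - {v}. pin_weight (pinned Es w P UNIV v c x) (\<phi> x)) =
        (\<Prod>x\<in>F - {v}. pin_weight (P x) (\<phi> x) * (if adj Es v x \<and> \<phi> x = c then w {v, x} else 1))"
      by (intro prod.cong) (auto simp: pinned_def)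
    also have "\<dots> = (\<Prod>x\<in>F - {v}. pin_weight (P x) (\<phi> x)) * (\<Prod>x \<in> ?N. w {v, x})"
      using fin by (simp only: prod.distrib prod.inter_filter finite_Diff)
    finally show ?thesis .
  qed
  ultimately show ?thesis
    unfolding colouring_weight_def edges by (simp only: mult_ac)
qed

lemma pinned_sum_Cons:
  assumes G: "simple_graph V Es" and F: "F \<subseteq> V" and v: "v \<in> F" "v \<notin> set W"
    and W: "set W \<subseteq> F" and c: "c \<in> {1..k}"
  shows "pinned_sum k Es w F P (v # W) (c # L) =
    pin_weight (P v) c * pinned_sum k Es w (F - {v}) (pinned Es w P UNIV v c) W L"
proof -
  let ?A = "{\<phi> \<in> F \<rightarrow>\<^sub>E {1..k}. \<forall>i<length (v # W). \<phi> ((v # W) ! i) = (c # L) ! i}"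
  let ?B = "{\<phi> \<in> (F - {v}) \<rightarrow>\<^sub>E {1..k}. \<forall>i<length W. \<phi> (W ! i) = L ! i}"
  have A: "?A = {\<phi> \<in> F \<rightarrow>\<^sub>E {1..k}. \<phi> v = c \<and> (\<forall>i<length W. \<phi> (W ! i) = L ! i)}"
    by (auto simp: nth_Cons split: nat.splits)
  have ne: "W ! i \<noteq> v" "W ! i \<in> F" if "i < length W" for i
    using that v W by auto
  have "pinned_sum k Es w F P (v # W) (c # L) = 
      (\<Sum>\<phi>\<in>?B. colouring_weight Es w F P (\<phi>(v := c)))"
    unfolding pinned_sum_def
  \<comment> \<open>Extensional functions are \<open>undefined\<close> off their domain, so
    restricting to \<open>F - {v}\<close> and setting the value at \<open>v\<close> to
    \<open>c\<close> are mutually inverse.\<close>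
  proof (rule sum.reindex_bij_witness[where j = "\<lambda>\<phi>. restrict \<phi> (F - {v})" and i = "\<lambda>\<phi>. \<phi>(v := c)"])
    fix \<phi> assume \<phi>: "\<phi> \<in> ?A"
    then have a: "\<phi> \<in> F \<rightarrow>\<^sub>E {1..k}" "\<phi> v = c" "\<And>i. i < length W \<Longrightarrow> \<phi> (W ! i) = L ! i"
      unfolding A by auto
    show restore: "(restrict \<phi> (F - {v}))(v := c) = \<phi>"
      using PiE_arb[OF a(1)] a(2) by (auto simp: fun_eq_iff)
    show "restrict \<phi> (F - {v}) \<in> ?B"
      using a ne by (auto simp: PiE_iff)
    show "colouring_weight Es w F P ((restrict \<phi> (F - {v}))(v := c)) = colouring_weight Es w F P \<phi>"
      by (simp only: restore)
  next
    fix \<phi> assume \<phi>: "\<phi> \<in> ?B"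
    then have p: "\<phi> \<in> (F - {v}) \<rightarrow>\<^sub>E {1..k}" by simp
    show "restrict (\<phi>(v := c)) (F - {v}) = \<phi>"
      using PiE_arb[OF p] by (auto simp: fun_eq_iff restrict_def)
    have "\<phi>(v := c) \<in> F \<rightarrow>\<^sub>E {1..k}"
      using p c v by (auto simp: PiE_iff extensional_def)
    then show "\<phi>(v := c) \<in> ?A"
      unfolding A using \<phi> ne by auto
  qed
  also have "\<dots> = pin_weight (P v) c * pinned_sum k Es w (F - {v}) (pinned Es w P UNIV v c) W L"
    by (simp only: colouring_weight_pin[OF G F v(1)] pinned_sum_def sum_distrib_left)
  finally show ?thesis .
qed

lemma pinned_sum_split:
  assumes G: "simple_graph V Es" and F: "F \<subseteq> V" and v: "v \<in> F"
  shows "pinned_sum k Es w F P [] [] =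
    (\<Sum>c\<in>{1..k}. pin_weight (P v) c * pinned_sum k Es w (F - {v}) (pinned Es w P UNIV v c) [] [])"
proof -
  have "finite F"
    using G F by (auto intro: finite_subset simp: simple_graph_def)
  then have fin: "finite (F \<rightarrow>\<^sub>E {1..k})"
    by (intro finite_PiE) auto
  have colours: "(\<lambda>\<phi>. \<phi> v) ` (F \<rightarrow>\<^sub>E {1..k}) \<subseteq> {1..k}"
    using v by (auto dest: PiE_mem)
  have "pinned_sum k Es w F P [] [] =
      (\<Sum>c\<in>{1..k}. \<Sum>\<phi> \<in> {\<phi> \<in> F \<rightarrow>\<^sub>E {1..k}. \<phi> v = c}. colouring_weight Es w F P \<phi>)"
    using sum.group[OF fin _ colours, of "colouring_weight Es w F P"] by (simp add: pinned_sum_def)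
  also have "\<dots> = (\<Sum>c\<in>{1..k}. pinned_sum k Es w F P [v] [c])"
    by (simp add: pinned_sum_def)
  also have "\<dots> = (\<Sum>c\<in>{1..k}. pin_weight (P v) c *
      pinned_sum k Es w (F - {v}) (pinned Es w P UNIV v c) [] [])"
    using v by (intro sum.cong refl pinned_sum_Cons[OF G F]) auto
  finally show ?thesis .
qed

definition pins :: "'a set set \<Rightarrow> ('a set \<Rightarrow> complex) \<Rightarrow> 'a list \<Rightarrow> nat list \<Rightarrow> 'a \<Rightarrow> (complex \<times> nat) list" where
  "pins Es w W L x = map (\<lambda>(v, c). (w {v, x}, c)) (filter (\<lambda>(v, c). adj Es v x) (zip W L))"

lemma pins_append:
  "length W = length L \<Longrightarrow> pins Es w (W @ [u]) (L @ [c]) = pinned Es w (pins Es w W L) UNIV u c"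
  by (simp add: pins_def pinned_def fun_eq_iff)

text \<open>The vertices of \<open>W\<close> are fixed one after another. By independence no new pin
  lands on a later vertex of \<open>W\<close>, so each prefactor is 1. The list \<open>W'\<close>
  may be adjacent to \<open>W\<close>; it is empty for (A) and (B) and is \<open>[u]\<close> for
  (C).\<close>

lemma pinned_sum_fix_independent:
  assumes G: "simple_graph V Es" and F: "F \<subseteq> V"
    and "distinct (W @ W')" "set (W @ W') \<subseteq> F" "length W = length L" "set L \<subseteq> {1..k}"
    and "\<forall>x\<in>set W. \<forall>y\<in>set W. \<not> adj Es x y" "\<forall>x\<in>set W. P x = []"
  shows "pinned_sum k Es w F P (W @ W') (L @ L') =
    pinned_sum k Es w (F - set W) (\<lambda>x. P x @ pins Es w W L x) W' L'"
  using assms(2-)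
proof (induction W arbitrary: F P L)
  case Nil
  then show ?case by (simp add: pins_def)
next
  case (Cons v W)
  then obtain c L0 where L: "L = c # L0" by (cases L) auto
  have "pinned_sum k Es w F P (v # (W @ W')) (c # (L0 @ L')) =
      pinned_sum k Es w (F - {v}) (pinned Es w P UNIV v c) (W @ W') (L0 @ L')"
    using Cons.prems L by (subst pinned_sum_Cons[OF G]) auto
  also have "\<dots> = pinned_sum k Es w (F - {v} - set W)
      (\<lambda>x. pinned Es w P UNIV v c x @ pins Es w W L0 x) W' L'"
    using Cons.prems L by (intro Cons.IH) (auto simp: pinned_def)
  also have "(\<lambda>x. pinned Es w P UNIV v c x @ pins Es w W L0 x) = (\<lambda>x. P x @ pins Es w (v # W) L x)"
    by (auto simp: pinned_def pins_def L fun_eq_iff)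
  also have "F - {v} - set W = F - set (v # W)"
    by auto
  finally show ?case by (simp add: L)
qed

section \<open>Zero-freeness and stability under recolouring\<close>

locale potts =
  fixes D k :: nat and eps K \<theta> :: real
    and V :: "'a set" and Es :: "'a set set" and w :: "'a set \<Rightarrow> complex"
  assumes D3: "D \<ge> 3"
    and kD: "k > D"
    and eps: "0 < eps" "eps < 1"
    and K: "0 < K" "K < 1 / (real D - 1)"
    and theta_def: "\<theta> = arcsin K"
    and theta: "0 < \<theta>" "\<theta> < pi / (3 * (real D - 1 + eps))"
    and cond: "\<And>d. d \<le> D - 1 \<Longrightarrow>
        0 < (1 + eps)^2 / ((real k - real (D - d)) * (1 - K)^d - eps * real (D - d))
      \<and> (1 + eps)^2 / ((real k - real (D - d)) * (1 - K)^d - eps * real (D - d)) \<le> K"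
    and G: "simple_graph V Es"
    and maxdeg: "max_degree_le V Es D"
    and weights: "\<And>e. e \<in> Es \<Longrightarrow>
        cmod (w e) \<le> eps \<or> (\<bar>Arg (w e)\<bar> \<le> eps * \<theta> \<and> eps < cmod (w e) \<and> cmod (w e) \<le> 1)"
begin

section \<open>Numerical consequences of the hypotheses\<close>

lemma K_bounds: "K < 1" "d \<le> D - 1 \<Longrightarrow> real d * K \<le> 1"
proof -
  have lt: "(real D - 1) * K < 1"
    using K D3 by (simp add: field_simps)
  have "1 * K \<le> (real D - 1) * K"
    using D3 K by (intro mult_right_mono) auto
  then show "K < 1" using lt by simp
  assume "d \<le> D - 1"
  then have "real d * K \<le> (real D - 1) * K"
    using D3 K by (intro mult_right_mono) auto
  then show "real d * K \<le> 1" using lt by simp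
qed

text \<open>The coefficient \<open>d + (D - d) * eps\<close> grows with \<open>d\<close> because
  \<open>eps < 1\<close>, and is \<open>D - 1 + eps\<close> at \<open>d = D - 1\<close>. The second
  bound rests on \<open>D \<le> 3/2 * (D - 1)\<close>, true for \<open>D \<ge> 3\<close>.\<close>

lemma angle_bounds:
  shows "d \<le> D - 1 \<Longrightarrow> (real d + real (D - d) * eps) * \<theta> < pi / 3"
    and "real D * \<theta> < pi / 2"
proof -
  have lt: "(real D - 1 + eps) * \<theta> < pi / 3"
    using theta D3 eps by (simp add: field_simps)
  {
    assume d: "d \<le> D - 1"
    have "0 \<le> (real D - 1 - real d) * (1 - eps)"
      using d D3 eps by (intro mult_nonneg_nonneg) auto
    then have "real d + real (D - d) * eps \<le> real D - 1 + eps"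
      using d D3 by (simp add: of_nat_diff algebra_simps)
    then have "(real d + real (D - d) * eps) * \<theta> \<le> (real D - 1 + eps) * \<theta>"
      using theta by (intro mult_right_mono) auto
    then show "(real d + real (D - d) * eps) * \<theta> < pi / 3"
      using lt by simp
  }
  have "real D * \<theta> \<le> (3 / 2 * (real D - 1 + eps)) * \<theta>"
    using D3 eps theta by (intro mult_right_mono) auto
  also have "\<dots> = 3 / 2 * ((real D - 1 + eps) * \<theta>)"
    by (simp only: mult.assoc)
  finally show "real D * \<theta> < pi / 2"
    using lt by linarith
qed

text \<open>The denominator in the hypothesis. It bounds a normalised colour sum from below: at
  least \<open>k - b\<close> colours give \<open>(1 - K)^d\<close> each, and each of the at most
  \<open>b\<close> others loses at most \<open>eps\<close>.\<close>

definition margin :: "nat \<Rightarrow> real" where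
  "margin d = (real k - real (D - d)) * (1 - K)^d - eps * real (D - d)"

lemma margin_ge:
  assumes "d \<le> D - 1"
  shows "(1 + eps)\<^sup>2 / K \<le> margin d"
proof -
  have "0 < (1 + eps)\<^sup>2 / margin d" "(1 + eps)\<^sup>2 / margin d \<le> K"
    using cond[OF assms] by (auto simp: margin_def)
  then have "margin d > 0" "(1 + eps)\<^sup>2 \<le> K * margin d"
    using eps by (auto simp: zero_less_divide_iff field_simps)
  then show ?thesis
    using K by (simp add: field_simps)
qed

text \<open>For \<open>d = 0\<close> the hypothesis is never attained with equality, because then it would fail for
  \<open>d = 1\<close>. This is what makes the ball in (B) open even at a vertex without free neighbours.\<close>

lemma margin_0_gt: "(1 + eps)\<^sup>2 / K < margin 0"
proof -
  define R where "R = (1 + eps)\<^sup>2 / K"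
  have "R \<le> real k - real D - eps * real D"
    using margin_ge[of 0] by (simp add: margin_def R_def)
  then have "R \<le> real k - real D"
    using eps by (smt (verit) mult_nonneg_nonneg of_nat_0_le_iff)
  then have "K * R \<le> K * (real k - real D)"
    using K by (intro mult_left_mono) auto
  moreover have "K * R = (1 + eps)\<^sup>2"
    using K by (simp add: R_def)
  moreover have "(1 + eps)\<^sup>2 > 1 + eps"
    using eps by (simp add: power2_eq_square)
  ultimately have "K * (real k - real D) > 1 + eps" by linarith
  moreover have "R \<le> margin 1"
    unfolding R_def using D3 by (intro margin_ge) simp
  \<comment> \<open>As \<open>K * (k - D)\<close> exceeds \<open>1 + eps\<close>, this identity
    gives \<open>margin 1 < margin 0\<close>.\<close>
  moreover have "margin 1 = margin 0 + 1 + eps - K * (real k - real D) - K"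
    using D3 by (simp add: margin_def of_nat_diff algebra_simps)
  ultimately show ?thesis
    unfolding R_def[symmetric] using K by linarith
qed

section \<open>Moduli and arguments of pin weights\<close>

definition ok_weight :: "complex \<Rightarrow> bool" where
  "ok_weight a \<longleftrightarrow>
     cmod a \<le> eps \<or> (\<bar>Arg a\<bar> \<le> eps * \<theta> \<and> eps < cmod a \<and> cmod a \<le> 1)"

definition ok_pins :: "(complex \<times> nat) list \<Rightarrow> bool" where
  "ok_pins p \<longleftrightarrow> (\<forall>q\<in>set p. ok_weight (fst q))"

definition bad :: "(complex \<times> nat) list \<Rightarrow> nat \<Rightarrow> bool" where
  "bad p c \<longleftrightarrow> (\<exists>q\<in>set p. snd q = c \<and> cmod (fst q) \<le> eps)"

lemma ok_pins_simps [simp]: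
  "ok_pins []" "ok_pins (q # p) \<longleftrightarrow> ok_weight (fst q) \<and> ok_pins p"
  "ok_pins (p @ p') \<longleftrightarrow> ok_pins p \<and> ok_pins p'"
  by (auto simp: ok_pins_def)

lemma bad_simps [simp]:
  "\<not> bad [] c" "bad (q # p) c \<longleftrightarrow> snd q = c \<and> cmod (fst q) \<le> eps \<or> bad p c"
  by (auto simp: bad_def)

lemma ok_weight_norm_le_1: "ok_weight a \<Longrightarrow> cmod a \<le> 1"
  using eps by (auto simp: ok_weight_def)

text \<open>The first factor of \<open>(1 + eps)^2\<close>. A small weight is handled by the
  triangle inequality; any other has modulus at most 1 and argument at most
  \<open>eps * \<theta> \<le> pi / 3\<close>, hence distance at most 1 from 1.\<close>

lemma ok_weight_norm_minus_1_le:
  assumes "ok_weight a"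
  shows "cmod (a - 1) \<le> 1 + eps"
proof (cases "cmod a \<le> eps")
  case True
  then show ?thesis
    using norm_triangle_ineq4[of a 1] by simp
next
  case False
  then have a: "\<bar>Arg a\<bar> \<le> eps * \<theta>" "cmod a \<le> 1"
    using assms by (auto simp: ok_weight_def)
  have "eps * \<theta> \<le> (real (D - 1) + real (D - (D - 1)) * eps) * \<theta>"
    using D3 theta by (intro mult_right_mono) auto
  then have "eps * \<theta> \<le> pi / 3"
    using angle_bounds(1)[of "D - 1"] by simp
  then have "cmod (a - 1) \<le> 1"
    using a by (intro cmod_diff_le_of_Arg_le) auto
  then show ?thesis using eps by simp
qed

lemma norm_pin_weight_le_1: "ok_pins p \<Longrightarrow> cmod (pin_weight p c) \<le> 1"
  by (induction p) (auto simp: norm_mult intro!: mult_le_one ok_weight_norm_le_1)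

lemma norm_pin_weight_bad_le: "ok_pins p \<Longrightarrow> bad p c \<Longrightarrow> cmod (pin_weight p c) \<le> eps"
proof (induction p)
  case (Cons q p)
  have p: "cmod (pin_weight p c) \<le> 1"
    using Cons.prems by (simp add: norm_pin_weight_le_1)
  show ?case
  proof (cases "bad p c")
    case True
    then have "cmod (pin_weight p c) \<le> eps" using Cons by simp
    then have "cmod (fst q) * cmod (pin_weight p c) \<le> 1 * eps"
      using Cons.prems ok_weight_norm_le_1 by (intro mult_mono) auto
    then show ?thesis
      using \<open>cmod (pin_weight p c) \<le> eps\<close> by (simp add: norm_mult)
  next
    case False
    then have "snd q = c" "cmod (fst q) \<le> eps" using Cons.prems by auto
    then have "cmod (fst q) * cmod (pin_weight p c) \<le> eps * 1"
      using p eps by (intro mult_mono) auto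
    then show ?thesis
      using \<open>snd q = c\<close> by (simp add: norm_mult)
  qed
qed simp

lemma pin_weight_nonzero: "\<not> bad p c \<Longrightarrow> pin_weight p c \<noteq> 0"
  using eps by (induction p) auto

text \<open>For \<open>l \<noteq> l'\<close> each pin enters at most one of the two weights and is
  charged once; bounding the weights separately would double the angle.\<close>

lemma abs_Arg_pin_weight_ratio_le:
  assumes "ok_pins p" "\<not> bad p l" "\<not> bad p l'"
  shows "\<bar>Arg (pin_weight p l / pin_weight p l')\<bar> \<le> real (length p) * (eps * \<theta>)"
proof (cases "l = l'")
  case True
  then show ?thesis
    using pin_weight_nonzero[OF assms(2)] eps theta by simp
next
  case False
  show ?thesis using assms
  proof (induction p)
    case (Cons q p)
    define f where "f c = (if snd q = c then fst q else 1)" for c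
    have "\<bar>Arg (f l / f l')\<bar> \<le> eps * \<theta>"
    proof -
      consider "snd q = l" | "snd q = l'" | "snd q \<noteq> l" "snd q \<noteq> l'" by blast
      then show ?thesis
      proof cases
        case 1
        then show ?thesis
          using False Cons.prems by (auto simp: f_def ok_weight_def)
      next
        case 2
        then show ?thesis
          using False Cons.prems abs_Arg_inverse[of "fst q"]
          by (auto simp: f_def ok_weight_def divide_inverse)
      next
        case 3
        then show ?thesis
          using eps theta by (simp add: f_def)
      qed
    qed
    moreover have "\<bar>Arg (pin_weight p l / pin_weight p l')\<bar> \<le> real (length p) * (eps * \<theta>)"
      using Cons by simp
    moreover have "pin_weight (q # p) l / pin_weight (q # p) l' =
        (f l / f l') * (pin_weight p l / pin_weight p l')"
      by (simp add: f_def)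
    ultimately show ?case
      using abs_Arg_mult_le[of "f l / f l'" "pin_weight p l / pin_weight p l'"]
      by (simp only: length_Cons) (simp add: algebra_simps)
  qed simp
qed

lemma abs_Arg_pin_weight_le:
  assumes "ok_pins p" "\<not> bad p l"
  shows "\<bar>Arg (pin_weight p l)\<bar> \<le> real (length p) * (eps * \<theta>)"
proof -
  \<comment> \<open>A colour used by no pin, possibly outside \<open>{1..k}\<close>: its weight is
    1, so the ratio bound becomes a bound on one weight.\<close>
  obtain c where c: "c \<notin> snd ` set p"
    using ex_new_if_finite[of "snd ` set p"] infinite_UNIV_nat by auto
  then have "\<not> bad p c" by (auto simp: bad_def)
  then show ?thesis
    using abs_Arg_pin_weight_ratio_le[OF assms, of c] pin_weight_eq_1[OF c] by simp
qed

section \<open>Lower bounds for weighted colour sums\<close>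

lemma Re_ball_pow_ge:
  assumes "y \<in> ball_pow 1 K d" "d \<le> D - 1"
  shows "(1 - K) ^ d \<le> Re y" and "d > 0 \<Longrightarrow> (1 - K) ^ d < Re y"
proof -
  have "real d * \<theta> \<le> real D * \<theta>"
    using assms D3 theta by (intro mult_right_mono) auto
  then have arg: "real d * arcsin K < pi / 2"
    using angle_bounds(2) by (simp add: theta_def)
  show strict: "(1 - K) ^ d < Re y" if "d > 0"
    using assms that K K_bounds arg by (intro Re_ball_pow_gt) auto
  show "(1 - K) ^ d \<le> Re y"
    using strict assms by (cases "d = 0") auto
qed

lemma ball_pow_nonzero: "y \<in> ball_pow 1 K d \<Longrightarrow> y \<noteq> 0"
  using K_bounds(1) by (fastforce simp: ball_pow_def)

text \<open>A colour without a pin contributes real part at least \<open>(1 - K)^d\<close>, a bad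
  colour has modulus at most \<open>eps\<close>, and any other pinned colour has argument below
  pi/2, hence nonnegative real part. These bounds add up to at least
  \<open>margin d\<close>.\<close>

lemma Re_weighted_sum_gt:
  assumes p: "ok_pins p" "length p \<le> D - d" and d: "d \<le> D - 1"
    and y: "\<And>c. c \<in> {1..k} \<Longrightarrow> y c \<in> ball_pow 1 K d"
    and y1: "\<And>c. c \<in> {1..k} \<Longrightarrow> cmod (y c) \<le> 1"
  shows "(1 + eps)\<^sup>2 / K < Re (\<Sum>c\<in>{1..k}. pin_weight p c * y c)"
proof -
  define C where "C = snd ` set p \<inter> {1..k}"
  define h where "h c = (if c \<in> C then - eps else (1 - K) ^ d)" for c
  have term_ge: "h c \<le> Re (pin_weight p c * y c)" if c: "c \<in> {1..k}" for c
  proof -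
    consider "c \<notin> C" | "c \<in> C" "bad p c" | "c \<in> C" "\<not> bad p c" by blast
    then show ?thesis
    proof cases
      case 1
      then have "pin_weight p c = 1"
        using c by (intro pin_weight_eq_1) (auto simp: C_def)
      then show ?thesis
        using 1 Re_ball_pow_ge(1)[OF y[OF c] d] by (simp add: h_def)
    next
      case 2
      have "cmod (pin_weight p c * y c) \<le> eps * 1"
        unfolding norm_mult using norm_pin_weight_bad_le[OF p(1) 2(2)] y1[OF c] eps
        by (intro mult_mono) auto
      then show ?thesis
        using abs_Re_le_cmod[of "pin_weight p c * y c"] 2 by (simp add: h_def)
    next
      case 3
      have "\<bar>Arg (pin_weight p c * y c)\<bar> \<le> real (length p) * (eps * \<theta>) + real d * \<theta>"
        using abs_Arg_mult_le[of "pin_weight p c" "y c"] abs_Arg_pin_weight_le[OF p(1) 3(2)]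
          abs_Arg_ball_pow_le[OF y[OF c] K(1) K_bounds(1)] by (simp add: theta_def)
      also have "\<dots> \<le> real (D - d) * (eps * \<theta>) + real d * \<theta>"
        using p eps theta by (intro add_right_mono mult_right_mono) auto
      also have "\<dots> = (real d + real (D - d) * eps) * \<theta>"
        by (simp add: algebra_simps)
      also have "\<dots> < pi / 3"
        by (rule angle_bounds(1)[OF d])
      also have "\<dots> \<le> pi / 2"
        by simp
      finally have "0 \<le> Re (pin_weight p c * y c)"
        using Arg_Re_nonneg[of "pin_weight p c * y c"] by linarith
      then show ?thesis
        using 3 eps by (simp add: h_def)
    qed
  qed
  have C: "C \<subseteq> {1..k}" "finite C"
    by (auto simp: C_def)
  have "card C \<le> card (snd ` set p)"
    by (intro card_mono) (auto simp: C_def)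
  also have "\<dots> \<le> length p"
    using card_image_le[of "set p" snd] card_length[of p] by simp
  finally have cC: "card C \<le> D - d"
    using p by simp
  have sum_h: "margin d \<le> (\<Sum>c\<in>{1..k}. h c)"
  proof -
    have "(\<Sum>c\<in>{1..k}. h c) = (\<Sum>c\<in>C. h c) + (\<Sum>c\<in>{1..k} - C. h c)"
      using C by (simp add: sum.subset_diff add.commute)
    also have "(\<Sum>c\<in>C. h c) = - eps * real (card C)"
      by (simp add: h_def)
    also have "(\<Sum>c\<in>{1..k} - C. h c) = (\<Sum>c\<in>{1..k} - C. (1 - K) ^ d)"
      by (intro sum.cong) (auto simp: h_def)
    also have "\<dots> = (real k - real (card C)) * (1 - K) ^ d"
      using C cC kD by (simp add: card_Diff_subset of_nat_diff)
    finally have "(\<Sum>c\<in>{1..k}. h c) = (real k - real (card C)) * (1 - K) ^ d - eps * real (card C)"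
      by simp
    moreover have "(real k - real (D - d)) * (1 - K) ^ d \<le> (real k - real (card C)) * (1 - K) ^ d"
      using cC K_bounds(1) by (intro mult_right_mono) auto
    moreover have "eps * real (card C) \<le> eps * real (D - d)"
      using cC eps by (intro mult_left_mono) auto
    ultimately show ?thesis
      by (simp add: margin_def)
  qed
  have sum_ge: "(\<Sum>c\<in>{1..k}. h c) \<le> Re (\<Sum>c\<in>{1..k}. pin_weight p c * y c)"
    unfolding Re_sum by (intro sum_mono term_ge)
  show ?thesis
  \<comment> \<open>Strictness has two sources: for \<open>d = 0\<close> the margin is strict; for
    \<open>d > 0\<close> some colour has no pin, as \<open>k > D\<close>, and its term exceeds
    \<open>(1 - K)^d\<close>.\<close>
  proof (cases "d = 0")
    case True
    then show ?thesis
      using sum_h sum_ge margin_0_gt by simp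
  next
    case False
    have "card C < card {1..k}"
      using cC kD by simp
    then obtain c where c: "c \<in> {1..k}" "c \<notin> C"
      by (metis C(1) psubsetI psubset_imp_ex_mem less_irrefl DiffD1 DiffD2)
    then have "pin_weight p c = 1"
      by (intro pin_weight_eq_1) (auto simp: C_def)
    then have "h c < Re (pin_weight p c * y c)"
      using c Re_ball_pow_ge(2)[OF y d] False by (simp add: h_def)
    then have "(\<Sum>c\<in>{1..k}. h c) < Re (\<Sum>c\<in>{1..k}. pin_weight p c * y c)"
      unfolding Re_sum using c term_ge by (intro sum_strict_mono_ex1) auto
    then show ?thesis
      using sum_h margin_ge[OF d] by simp
  qed
qed

text \<open>The numerical hypothesis stops at \<open>d = D - 1\<close>. A vertex with
  \<open>D\<close> free neighbours carries no pin, and \<open>D * \<theta> < pi / 2\<close> puts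
  every term in the open right half-plane.\<close>

lemma Re_sum_pos_full_degree:
  assumes y: "\<And>c. c \<in> {1..k} \<Longrightarrow> y c \<in> ball_pow 1 K D"
  shows "0 < Re (\<Sum>c\<in>{1..k}. y c)"
proof -
  have "0 < Re (y c)" if "c \<in> {1..k}" for c
    using Arg_Re_pos[of "y c"] abs_Arg_ball_pow_le[OF y[OF that] K(1) K_bounds(1)]
      angle_bounds(2) ball_pow_nonzero[OF y[OF that]] by (simp add: theta_def)
  then show ?thesis
    unfolding Re_sum using kD by (intro sum_pos) auto
qed

section \<open>The induction on the set of free vertices\<close>

abbreviation Z :: "'a set \<Rightarrow> ('a \<Rightarrow> (complex \<times> nat) list) \<Rightarrow> complex" where
  "Z F P \<equiv> pinned_sum k Es w F P [] []"

abbreviation pin :: "('a \<Rightarrow> (complex \<times> nat) list) \<Rightarrow> 'a set \<Rightarrow> 'a \<Rightarrow> nat \<Rightarrow> 'a \<Rightarrow> (complex \<times> nat) list"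
  where "pin \<equiv> pinned Es w"

definition nbrs :: "'a set \<Rightarrow> 'a \<Rightarrow> 'a set" where
  "nbrs F x = {y \<in> F. adj Es x y}"

text \<open>Pins count towards the degree: fixing a vertex turns each of its edges to a remaining
  vertex into a pin there, so the bound \<open>D\<close> survives.\<close>

definition admissible :: "'a set \<Rightarrow> ('a \<Rightarrow> (complex \<times> nat) list) \<Rightarrow> bool" where
  "admissible F P \<longleftrightarrow> (\<forall>x\<in>F. card (nbrs F x) + length (P x) \<le> D \<and> ok_pins (P x))"

definition nonvanishing :: "'a set \<Rightarrow> bool" where
  "nonvanishing F \<longleftrightarrow> (\<forall>P. admissible F P \<longrightarrow> Z F P \<noteq> 0)"

definition stable :: "'a set \<Rightarrow> bool" where
  "stable F \<longleftrightarrow> (\<forall>P. \<forall>x\<in>F. \<forall>a. \<forall>l\<in>{1..k}. \<forall>j\<in>{1..k}. admissible F (P(x := P x @ [(a, l)])) \<longrightarrow>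
     Z F (P(x := P x @ [(a, l)])) / Z F (P(x := P x @ [(a, j)])) \<in> ball 1 K)"

lemma finite_subset_V: "F \<subseteq> V \<Longrightarrow> finite F"
  using G by (auto intro: finite_subset simp: simple_graph_def)

lemma not_adj_self: "\<not> adj Es v v"
  using G by (auto simp: adj_def simple_graph_def)

lemma ok_weight_edge: "adj Es x y \<Longrightarrow> ok_weight (w {x, y})"
  using weights by (auto simp: adj_def ok_weight_def)

lemma admissible_recolour_pin: "admissible F (pin P S v l) \<Longrightarrow> admissible F (pin P S v j)"
  by (auto simp: admissible_def pinned_def split: if_splits)

text \<open>The pins are recoloured one at a time and the ratio telescopes: each recolouring gives a
  factor in \<open>ball 1 K\<close> by stability, and the intermediate values cancel because they
  are nonzero.\<close>

lemma pin_ratio_in_ball_pow: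
  assumes F: "nonvanishing F" "stable F"
    and S: "finite S" "S \<subseteq> F" "\<forall>x\<in>S. adj Es v x"
    and adm: "admissible F (pin P S v l)" and lj: "l \<in> {1..k}" "j \<in> {1..k}"
  shows "Z F (pin P S v l) / Z F (pin P S v j) \<in> ball_pow 1 K (card S)"
  using S adm
proof (induction S arbitrary: P)
  case empty
  then have "Z F (pin P {} v l) \<noteq> 0"
    using F by (auto simp: nonvanishing_def)
  moreover have "pin P {} v l = pin P {} v j"
    by (simp add: pinned_def fun_eq_iff)
  ultimately show ?case by simp
next
  case (insert x S)
  define a where "a = w {v, x}"
  define P1 where "P1 = P(x := P x @ [(a, l)])"
  define Q where "Q = pin P S v j"
  have e1: "pin P (insert x S) v l = pin P1 S v l"
    using insert.hyps insert.prems by (auto simp: pinned_def P1_def a_def fun_eq_iff)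
  \<comment> \<open>The intermediate configuration: the pins of \<open>v\<close> on \<open>S\<close>
    already have colour \<open>j\<close>, the one at \<open>x\<close> still has colour
    \<open>l\<close>.\<close>
  have e2: "pin P1 S v j = Q(x := Q x @ [(a, l)])"
    using insert.hyps insert.prems by (auto simp: pinned_def P1_def Q_def a_def fun_eq_iff)
  have e3: "pin P (insert x S) v j = Q(x := Q x @ [(a, j)])"
    using insert.hyps insert.prems by (auto simp: pinned_def Q_def a_def fun_eq_iff)
  have adm: "admissible F (pin P1 S v l)"
    using insert.prems by (simp add: e1)
  then have adm': "admissible F (Q(x := Q x @ [(a, l)]))"
    by (simp add: e2[symmetric] admissible_recolour_pin)
  have "Z F (pin P1 S v l) / Z F (pin P1 S v j) \<in> ball_pow 1 K (card S)"
    using insert.prems adm by (intro insert.IH) auto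
  moreover have "Z F (Q(x := Q x @ [(a, l)])) / Z F (Q(x := Q x @ [(a, j)])) \<in> ball 1 K"
    using F(2) insert.prems lj adm' unfolding stable_def by blast
  moreover have "Z F (Q(x := Q x @ [(a, l)])) \<noteq> 0"
    using F(1) adm' by (auto simp: nonvanishing_def)
  ultimately have "Z F (pin P1 S v l) / Z F (Q(x := Q x @ [(a, j)])) \<in> ball_pow 1 K (Suc (card S))"
    using ball_pow_Suc_I by (fastforce simp: e2)
  then show ?case
    by (simp only: e1 e3 card_insert_disjoint[OF insert.hyps])
qed

lemma admissible_pin:
  assumes "admissible F P" "v \<in> F" "F \<subseteq> V"
  shows "admissible (F - {v}) (pin P S v c)"
proof -
  have "card (nbrs (F - {v}) x) + length (pin P S v c x) \<le> D \<and> ok_pins (pin P S v c x)"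
    if x: "x \<in> F - {v}" for x
  proof -
    have P: "card (nbrs F x) + length (P x) \<le> D" "ok_pins (P x)"
      using assms x by (auto simp: admissible_def)
    have fin: "finite (nbrs F x)"
      using finite_subset_V[OF assms(3)] by (simp add: nbrs_def)
    show ?thesis
    proof (cases "adj Es v x")
      case True
      then have "nbrs F x = insert v (nbrs (F - {v}) x)"
        using assms by (auto simp: nbrs_def adj_commute)
      then have "card (nbrs F x) = Suc (card (nbrs (F - {v}) x))"
        using fin by (simp add: nbrs_def)
      then show ?thesis
        using P ok_weight_edge[OF True] by (simp add: pinned_def)
    next
      case False
      have "card (nbrs (F - {v}) x) \<le> card (nbrs F x)"
        using fin by (intro card_mono) (auto simp: nbrs_def)
      then show ?thesis
        using P False by (simp add: pinned_def)
    qed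
  qed
  then show ?thesis
    by (simp add: admissible_def)
qed

lemma fixed_vertex_ratio:
  assumes F: "F \<subseteq> V" "v \<in> F" and adm: "admissible F P"
    and F': "nonvanishing (F - {v})" "stable (F - {v})"
    and l: "l \<in> {1..k}"
  shows "Z (F - {v}) (pin P UNIV v l) \<noteq> 0"
    and "j \<in> {1..k} \<Longrightarrow> Z (F - {v}) (pin P UNIV v l) / Z (F - {v}) (pin P UNIV v j)
           \<in> ball_pow 1 K (card (nbrs F v))"
proof -
  show "Z (F - {v}) (pin P UNIV v l) \<noteq> 0"
    using admissible_pin[OF adm F(2,1)] F' by (auto simp: nonvanishing_def)
  assume j: "j \<in> {1..k}"
  have "Z (F - {v}) (pin P UNIV v c) = Z (F - {v}) (pin P (nbrs F v) v c)" for c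
    by (intro pinned_sum_cong) (auto simp: pinned_def nbrs_def)
  moreover have "Z (F - {v}) (pin P (nbrs F v) v l) / Z (F - {v}) (pin P (nbrs F v) v j)
      \<in> ball_pow 1 K (card (nbrs F v))"
    using F' l j admissible_pin[OF adm F(2,1)] finite_subset_V[OF F(1)] not_adj_self
    by (intro pin_ratio_in_ball_pow) (auto simp: nbrs_def)
  ultimately show "Z (F - {v}) (pin P UNIV v l) / Z (F - {v}) (pin P UNIV v j)
      \<in> ball_pow 1 K (card (nbrs F v))"
    by simp
qed

text \<open>Dividing by the value \<open>X m\<close> of largest modulus gives
  \<open>cmod (y l) \<le> 1\<close>. The same \<open>X0\<close> and \<open>y\<close> serve every
  list \<open>p\<close> of pins at \<open>v\<close>, which allows two colours of one pin to be
  compared.\<close>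

lemma Z_split_normalised:
  assumes F: "F \<subseteq> V" "v \<in> F" and adm: "admissible F P"
    and F': "nonvanishing (F - {v})" "stable (F - {v})"
  shows "\<exists>X0 y. X0 \<noteq> 0
    \<and> (\<forall>l\<in>{1..k}. y l \<noteq> 0 \<and> cmod (y l) \<le> 1 \<and> y l \<in> ball_pow 1 K (card (nbrs F v)))
    \<and> (\<forall>l\<in>{1..k}. \<forall>j\<in>{1..k}. y l / y j \<in> ball_pow 1 K (card (nbrs F v)))
    \<and> (\<forall>p. Z F (P(v := p)) = X0 * (\<Sum>c\<in>{1..k}. pin_weight p c * y c))"
proof -
  define X where "X c = Z (F - {v}) (pin P UNIV v c)" for c
  have X: "X l \<noteq> 0" "\<And>j. j \<in> {1..k} \<Longrightarrow> X l / X j \<in> ball_pow 1 K (card (nbrs F v))"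
    if "l \<in> {1..k}" for l
    unfolding X_def using fixed_vertex_ratio[OF assms that] by auto
  have "Max ((\<lambda>c. cmod (X c)) ` {1..k}) \<in> (\<lambda>c. cmod (X c)) ` {1..k}"
    using kD by (intro Max_in) auto
  then obtain m where m: "m \<in> {1..k}" and "cmod (X m) = Max ((\<lambda>c. cmod (X c)) ` {1..k})"
    by auto
  then have max: "cmod (X c) \<le> cmod (X m)" if "c \<in> {1..k}" for c
    using that by simp
  show ?thesis
  proof (intro exI conjI ballI allI)
    show "X m \<noteq> 0"
      using X m by simp
  next
    fix l assume l: "l \<in> {1..k}"
    show "X l / X m \<noteq> 0" "cmod (X l / X m) \<le> 1" "X l / X m \<in> ball_pow 1 K (card (nbrs F v))"
      using X l m max[OF l] by (auto simp: norm_divide)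
  next
    fix l j assume lj: "l \<in> {1..k}" "j \<in> {1..k}"
    have "(X l / X m) / (X j / X m) = X l / X j"
      using X(1)[OF m] by simp
    then show "(X l / X m) / (X j / X m) \<in> ball_pow 1 K (card (nbrs F v))"
      using X(2)[OF lj] by (simp only:)
  next
    fix p
    have "Z (F - {v}) (pin (P(v := p)) UNIV v c) = X c" for c
      unfolding X_def by (intro pinned_sum_cong) (auto simp: pinned_def)
    then have "Z F (P(v := p)) = (\<Sum>c\<in>{1..k}. pin_weight p c * X c)"
      using pinned_sum_split[OF G F, of k w "P(v := p)"] by simp
    then show "Z F (P(v := p)) = X m * (\<Sum>c\<in>{1..k}. pin_weight p c * (X c / X m))"
      using X(1)[OF m] by (simp add: sum_distrib_left)
  qed
qed

lemma nonvanishing_step: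
  assumes F: "F \<subseteq> V" "v \<in> F" and F': "nonvanishing (F - {v})" "stable (F - {v})"
  shows "nonvanishing F"
  unfolding nonvanishing_def
proof (intro allI impI)
  fix P assume adm: "admissible F P"
  let ?d = "card (nbrs F v)"
  have d: "?d + length (P v) \<le> D" and ok: "ok_pins (P v)"
    using adm F by (auto simp: admissible_def)
  obtain X0 y where X0: "X0 \<noteq> 0"
    and y: "\<forall>l\<in>{1..k}. y l \<noteq> 0 \<and> cmod (y l) \<le> 1 \<and> y l \<in> ball_pow 1 K ?d"
    and Z: "\<forall>p. Z F (P(v := p)) = X0 * (\<Sum>c\<in>{1..k}. pin_weight p c * y c)"
    using Z_split_normalised[OF F adm F'] by blast
  have "0 < Re (\<Sum>c\<in>{1..k}. pin_weight (P v) c * y c)"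
  proof (cases "?d \<le> D - 1")
    case True
    have "0 < (1 + eps)\<^sup>2 / K"
      using eps K by simp
    also have "\<dots> < Re (\<Sum>c\<in>{1..k}. pin_weight (P v) c * y c)"
      using d ok y True by (intro Re_weighted_sum_gt) auto
    finally show ?thesis .
  next
    case False
    \<comment> \<open>Full degree leaves no room for pins at \<open>v\<close>, so all its pin
      weights are 1.\<close>
    then have "?d = D" "length (P v) = 0"
      using d D3 by linarith+
    then show ?thesis
      using Re_sum_pos_full_degree[of y] y by simp
  qed
  then have "(\<Sum>c\<in>{1..k}. pin_weight (P v) c * y c) \<noteq> 0"
    by (auto simp del: Re_sum)
  then show "Z F P \<noteq> 0"
    using spec[OF Z, of "P v"] X0 by simp
qed

text \<open>The second factor of \<open>(1 + eps)^2\<close>. If \<open>l\<close> or \<open>j\<close>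
  is bad, one term has modulus at most \<open>eps\<close> and the other at most 1. Otherwise the
  angle between the terms is at most pi/3, so they differ by at most 1.\<close>

lemma cmod_pin_weight_diff_le:
  assumes p: "ok_pins p" "length p \<le> D - d" and d: "d \<le> D - 1"
    and y: "cmod (y l) \<le> 1" "cmod (y j) \<le> 1" "y j \<noteq> 0" "y l / y j \<in> ball_pow 1 K d"
  shows "cmod (pin_weight p l * y l - pin_weight p j * y j) \<le> 1 + eps"
proof (cases "bad p l \<or> bad p j")
  case True
  have le: "cmod (pin_weight p c * y c) \<le> (if bad p c then eps else 1)" if "cmod (y c) \<le> 1" for c
  proof -
    have "cmod (pin_weight p c) \<le> (if bad p c then eps else 1)"
      using norm_pin_weight_bad_le norm_pin_weight_le_1 p(1) by simp
    then have "cmod (pin_weight p c * y c) \<le> (if bad p c then eps else 1) * 1"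
      unfolding norm_mult using that eps by (intro mult_mono) auto
    then show ?thesis by simp
  qed
  show ?thesis
    using norm_triangle_ineq4[of "pin_weight p l * y l" "pin_weight p j * y j"]
      le[OF y(1)] le[OF y(2)] True eps by (auto split: if_splits)
next
  case False
  let ?r = "(pin_weight p l * y l) / (pin_weight p j * y j)"
  have "?r = (pin_weight p l / pin_weight p j) * (y l / y j)"
    by simp
  then have "\<bar>Arg ?r\<bar> \<le> real (length p) * (eps * \<theta>) + real d * \<theta>"
    using abs_Arg_mult_le[of "pin_weight p l / pin_weight p j" "y l / y j"]
      abs_Arg_pin_weight_ratio_le[OF p(1), of l j] False
      abs_Arg_ball_pow_le[OF y(4) K(1) K_bounds(1)]
    by (simp only: theta_def) linarith
  also have "\<dots> \<le> real (D - d) * (eps * \<theta>) + real d * \<theta>"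
    using p eps theta by (intro add_right_mono mult_right_mono) auto
  also have "\<dots> = (real d + real (D - d) * eps) * \<theta>"
    by (simp add: algebra_simps)
  also have "\<dots> \<le> pi / 3"
    using angle_bounds(1)[OF d] by simp
  finally have "cmod (pin_weight p l * y l - pin_weight p j * y j) \<le> 1"
    using y norm_pin_weight_le_1[OF p(1)] pin_weight_nonzero[of p j] False
    by (intro cmod_diff_le_of_Arg_le) (auto simp: norm_mult intro!: mult_le_one)
  then show ?thesis
    using eps by simp
qed

text \<open>Recolouring changes the colour sum by \<open>(a - 1) * (q l * y l - q j * y j)\<close>,
  at most \<open>(1 + eps)^2\<close> in modulus, while the sum itself exceeds
  \<open>(1 + eps)^2 / K\<close> in modulus.\<close>

lemma stable_step:
  assumes F: "F \<subseteq> V" and F': "\<And>v. v \<in> F \<Longrightarrow> nonvanishing (F - {v}) \<and> stable (F - {v})"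
  shows "stable F"
  unfolding stable_def
proof (intro allI ballI impI)
  fix P v a l j
  assume v: "v \<in> F" and l: "l \<in> {1..k}" and j: "j \<in> {1..k}"
    and adm: "admissible F (P(v := P v @ [(a, l)]))"
  let ?d = "card (nbrs F v)"
  have d: "?d + Suc (length (P v)) \<le> D" and ok: "ok_pins (P v)" "ok_weight a"
    using adm v by (auto simp: admissible_def)
  obtain X0 y where X0: "X0 \<noteq> 0"
    and y: "\<forall>l\<in>{1..k}. y l \<noteq> 0 \<and> cmod (y l) \<le> 1 \<and> y l \<in> ball_pow 1 K ?d"
    and yy: "\<forall>l\<in>{1..k}. \<forall>j\<in>{1..k}. y l / y j \<in> ball_pow 1 K ?d"
    and Z: "\<forall>p. Z F (P(v := p)) = X0 * (\<Sum>c\<in>{1..k}. pin_weight p c * y c)"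
    using Z_split_normalised[OF F v adm conjunct1[OF F'[OF v]] conjunct2[OF F'[OF v]],
        unfolded fun_upd_upd] by blast
  define q where "q = pin_weight (P v)"
  define T where "T m = (\<Sum>c\<in>{1..k}. pin_weight (P v @ [(a, m)]) c * y c)" for m
  define S where "S = (\<Sum>c\<in>{1..k}. q c * y c)"
  have T: "T m = S + (a - 1) * (q m * y m)" if m: "m \<in> {1..k}" for m
  proof -
    have "T m = (\<Sum>c\<in>{1..k}. q c * y c + (if c = m then (a - 1) * (q m * y m) else 0))"
      unfolding T_def by (intro sum.cong) (auto simp: q_def algebra_simps)
    then show ?thesis
      using m by (simp add: sum.distrib S_def)
  qed
  \<comment> \<open>The recoloured pin takes one of the \<open>D\<close> places at \<open>v\<close>,
    so \<open>?d \<le> D - 1\<close>.\<close>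
  have "(1 + eps)\<^sup>2 / K < Re (T j)"
    unfolding T_def using d ok y by (intro Re_weighted_sum_gt[where d = ?d]) auto
  then have den: "(1 + eps)\<^sup>2 / K < cmod (T j)"
    using complex_Re_le_cmod[of "T j"] by linarith
  moreover have "0 < (1 + eps)\<^sup>2 / K"
    using eps K by simp
  ultimately have T0: "T j \<noteq> 0" by auto
  have "cmod (T l - T j) = cmod (a - 1) * cmod (q l * y l - q j * y j)"
    unfolding T[OF l] T[OF j] norm_mult[symmetric] by (simp add: algebra_simps)
  also have "\<dots> \<le> (1 + eps) * (1 + eps)"
    using ok d y yy l j eps unfolding q_def
    by (intro mult_mono ok_weight_norm_minus_1_le cmod_pin_weight_diff_le[where d = ?d]) auto
  also have "\<dots> < K * cmod (T j)"
    using den K by (simp add: field_simps power2_eq_square)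
  finally have "cmod (T l / T j - 1) < K"
    using T0 by (simp add: diff_divide_eq_iff norm_divide field_simps)
  moreover have "Z F (P(v := P v @ [(a, l)])) / Z F (P(v := P v @ [(a, j)])) = T l / T j"
    using X0 by (simp add: Z T_def)
  ultimately show "Z F (P(v := P v @ [(a, l)])) / Z F (P(v := P v @ [(a, j)])) \<in> ball 1 K"
    by (simp add: dist_norm norm_minus_commute)
qed

lemma nonvanishing_empty: "nonvanishing {}"
proof -
  have "{} \<notin> Es"
    using G by (force simp: simple_graph_def)
  then show ?thesis
    by (simp add: nonvanishing_def pinned_sum_def colouring_weight_def)
qed

text \<open>Each of the two steps uses both properties of \<open>F - {v}\<close>. Stability needs
  them for every \<open>v\<close> in \<open>F\<close>, because the recoloured pin may sit
  anywhere.\<close>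

theorem nonvanishing_stable:
  assumes "F \<subseteq> V"
  shows "nonvanishing F \<and> stable F"
  using finite_subset_V[OF assms] assms
proof (induction F rule: finite_psubset_induct)
  case (psubset F)
  have IH: "nonvanishing (F - {v}) \<and> stable (F - {v})" if "v \<in> F" for v
    using that psubset by (intro psubset.IH) auto
  then have "stable F"
    using psubset.prems by (intro stable_step) auto
  moreover have "nonvanishing F"
    using IH nonvanishing_empty nonvanishing_step[OF psubset.prems] by (cases "F = {}") auto
  ultimately show ?case by simp
qed

section \<open>Back to restricted partition functions\<close>

lemma length_pins:
  assumes "distinct W" "length W = length L"
  shows "length (pins Es w W L x) = card {v \<in> set W. adj Es v x}"
proof -
  have "length (filter (\<lambda>(v, c). adj Es v x) (zip W L)) = length (filter (\<lambda>v. adj Es v x) W)"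
    using assms(2) by (induction W L rule: list_induct2) auto
  also have "\<dots> = card (set (filter (\<lambda>v. adj Es v x) W))"
    using assms(1) by (intro distinct_card[symmetric] distinct_filter)
  finally show ?thesis
    by (simp add: pins_def)
qed

lemma admissible_pins:
  assumes "distinct W" "length W = length L" "set W \<subseteq> V"
  shows "admissible (V - set W) (pins Es w W L)"
proof -
  have "card (nbrs (V - set W) x) + length (pins Es w W L x) \<le> D \<and> ok_pins (pins Es w W L x)"
    if "x \<in> V - set W" for x
  proof
    have "card (nbrs (V - set W) x) + card {v \<in> set W. adj Es v x} =
        card (nbrs (V - set W) x \<union> {v \<in> set W. adj Es v x})"
      using finite_subset_V[of V] by (subst card_Un_disjoint) (auto simp: nbrs_def)
    also have "nbrs (V - set W) x \<union> {v \<in> set W. adj Es v x} = {v \<in> V. adj Es x v}"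
      using assms by (auto simp: nbrs_def adj_commute)
    also have "card \<dots> \<le> D"
      using maxdeg that by (auto simp: max_degree_le_def degree_def)
    finally show "card (nbrs (V - set W) x) + length (pins Es w W L x) \<le> D"
      using assms by (simp add: length_pins)
    show "ok_pins (pins Es w W L x)"
      by (auto simp: ok_pins_def pins_def ok_weight_edge)
  qed
  then show ?thesis
    by (simp add: admissible_def)
qed

lemma set_pins:
  assumes "length W = length L"
  shows "set (pins Es w W L u) = {(w {u, W ! i}, L ! i) | i. i < length W \<and> adj Es u (W ! i)}"
  using assms by (fastforce simp: pins_def set_zip adj_commute insert_commute image_iff)

lemma good_colour_iff:
  "length W = length L \<Longrightarrow> good_colour Es W L u l \<longleftrightarrow> l \<notin> snd ` set (pins Es w W L u)"
  by (auto simp: good_colour_def set_pins image_iff)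

lemma bad_colour_iff:
  "length W = length L \<Longrightarrow> bad_colour Es w eps W L u l \<longleftrightarrow> bad (pins Es w W L u) l"
  by (auto simp: bad_colour_def bad_def set_pins)

lemma Zr_eq_Z:
  assumes "distinct W" "set W \<subseteq> V" "length W = length L" "set L \<subseteq> {1..k}"
    and "\<forall>x\<in>set W. \<forall>y\<in>set W. \<not> adj Es x y"
  shows "Zr k V Es w W L = Z (V - set W) (pins Es w W L)"
  using pinned_sum_fix_independent[OF G order_refl, of W "[]" L k "\<lambda>_. []" w "[]"] assms
  by (simp add: Zr_eq_pinned_sum[OF G])

text \<open>Unlike the vertices of \<open>W\<close>, the last vertex \<open>u\<close> may have
  neighbours in \<open>W\<close>. Their pins at \<open>u\<close> give the prefactor, on which the
  distinction of good, neutral and bad colours rests.\<close>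

lemma Zr_snoc_eq:
  assumes "distinct (W @ [u])" "set W \<subseteq> V" "length W = length L" "set L \<subseteq> {1..k}"
    and "\<forall>x\<in>set W. \<forall>y\<in>set W. \<not> adj Es x y" and "u \<in> V" "c \<in> {1..k}"
  shows "Zr k V Es w (W @ [u]) (L @ [c]) =
    pin_weight (pins Es w W L u) c * Z (V - set W - {u}) (pin (pins Es w W L) UNIV u c)"
proof -
  have "Zr k V Es w (W @ [u]) (L @ [c]) =
      pinned_sum k Es w (V - set W) (pins Es w W L) [u] [c]"
    using pinned_sum_fix_independent[OF G order_refl, of W "[u]" L k "\<lambda>_. []" w "[c]"] assms
    by (simp add: Zr_eq_pinned_sum[OF G])
  also have "\<dots> = pin_weight (pins Es w W L u) c * Z (V - set W - {u}) (pin (pins Es w W L) UNIV u c)"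
    using assms by (intro pinned_sum_Cons[OF G]) auto
  finally show ?thesis .
qed

lemma Zr_leaf_independent_nonzero:
  assumes "distinct W" "leaf_independent V Es (set W)" "length L = length W" "set L \<subseteq> {1..k}"
  shows "Zr k V Es w W L \<noteq> 0"
proof -
  have "Zr k V Es w W L = Z (V - set W) (pins Es w W L)"
    using assms by (intro Zr_eq_Z) (auto simp: leaf_independent_def)
  then show ?thesis
    using nonvanishing_stable[of "V - set W"] admissible_pins[of W L] assms
    by (auto simp: nonvanishing_def leaf_independent_def)
qed

text \<open>The leaf \<open>u\<close> has a single neighbour \<open>v\<close>, free by independence.
  Fixing \<open>u\<close> adds one pin at \<open>v\<close>, and changing the colour of
  \<open>u\<close> recolours that pin.\<close>

lemma Zr_leaf_ratio_in_ball:
  assumes dist: "distinct (W @ [u])" and leaf: "leaf_independent V Es (set (W @ [u]))"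
    and L: "length L = length W" "set L \<subseteq> {1..k}" and l: "l \<in> {1..k}" and j: "j \<in> {1..k}"
  shows "Zr k V Es w (W @ [u]) (L @ [l]) / Zr k V Es w (W @ [u]) (L @ [j]) \<in> ball 1 K"
proof -
  let ?F = "V - set (W @ [u])"
  define P where "P = pins Es w W L"
  have u: "u \<in> V" and W: "set W \<subseteq> V" and ind: "\<forall>x\<in>set (W @ [u]). \<forall>y\<in>set (W @ [u]). \<not> adj Es x y"
    using leaf by (auto simp: leaf_independent_def)
  have "card {y \<in> V. adj Es u y} = 1"
    using leaf by (auto simp: leaf_independent_def degree_def)
  then obtain v where v: "{y \<in> V. adj Es u y} = {v}"
    by (auto simp: card_1_singleton_iff)
  have "adj Es u x \<Longrightarrow> x \<in> V" for x
    using G by (auto simp: adj_def simple_graph_def)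
  then have adj: "adj Es u x \<longleftrightarrow> x = v" for x
    using v by auto
  have vF: "v \<in> ?F"
    using v ind adj by auto
  have pins: "pins Es w (W @ [u]) (L @ [c]) = P(v := P v @ [(w {u, v}, c)])" for c
    using L by (auto simp: pins_append P_def pinned_def adj fun_eq_iff)
  have Z: "Zr k V Es w (W @ [u]) (L @ [c]) = Z ?F (P(v := P v @ [(w {u, v}, c)]))"
    if "c \<in> {1..k}" for c
    unfolding pins[symmetric] using dist W u L ind that by (intro Zr_eq_Z) auto
  have "admissible ?F (P(v := P v @ [(w {u, v}, l)]))"
    unfolding pins[symmetric] using dist W u L by (intro admissible_pins) auto
  then show ?thesis
    using nonvanishing_stable[of ?F] vF l j unfolding Z[OF l] Z[OF j] stable_def by blast
qed

text \<open>Each value is a pin weight at \<open>u\<close> times \<open>X c\<close>, with ratios of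
  the \<open>X c\<close> in the ball power. Good colours have pin weight 1; good and neutral colours
  are not bad, so their pin weights are nonzero and contribute at most
  \<open>(D - d) * eps * \<theta>\<close> to the angle.\<close>

lemma Zr_fixed_vertex:
  assumes dist: "distinct (W @ [u])" and u: "u \<in> V" and leaf: "leaf_independent V Es (set W)"
    and L: "length L = length W" "set L \<subseteq> {1..k}"
  defines "d \<equiv> card {v \<in> V. adj Es u v \<and> v \<notin> set W}"
  defines "GN \<equiv> {l \<in> {1..k}. good_colour Es W L u l \<or> neutral_colour Es w eps W L u l}"
  shows "l \<in> GN \<Longrightarrow> Zr k V Es w (W @ [u]) (L @ [l]) \<noteq> 0"
    and "l \<in> GN \<Longrightarrow> j \<in> GN \<Longrightarrow> cangle (Zr k V Es w (W @ [u]) (L @ [l])) (Zr k V Es w (W @ [u]) (L @ [j]))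
           \<le> (real d + real (D - d) * eps) * \<theta>"
    and "l \<in> {1..k} \<Longrightarrow> j \<in> {1..k} \<Longrightarrow> good_colour Es W L u l \<Longrightarrow> good_colour Es W L u j \<Longrightarrow>
           Zr k V Es w (W @ [u]) (L @ [l]) / Zr k V Es w (W @ [u]) (L @ [j]) \<in> ball_pow 1 K d"
proof -
  let ?F = "V - set W"
  define P where "P = pins Es w W L"
  define X where "X c = Z (?F - {u}) (pin P UNIV u c)" for c
  have W: "set W \<subseteq> V" "\<forall>x\<in>set W. \<forall>y\<in>set W. \<not> adj Es x y"
    using leaf by (auto simp: leaf_independent_def)
  have uF: "u \<in> ?F" using dist u by simp
  have adm: "admissible ?F P"
    unfolding P_def using dist W L by (intro admissible_pins) auto
  have d: "d = card (nbrs ?F u)"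
    unfolding d_def nbrs_def by (rule arg_cong[where f = card]) auto
  have ok: "ok_pins (P u)" "length (P u) \<le> D - d"
    using bspec[OF adm[unfolded admissible_def] uF] unfolding d by linarith+
  have Z: "Zr k V Es w (W @ [u]) (L @ [c]) = pin_weight (P u) c * X c" if "c \<in> {1..k}" for c
    unfolding P_def X_def using dist W u L that by (intro Zr_snoc_eq) auto
  have X: "X l \<noteq> 0" "j \<in> {1..k} \<Longrightarrow> X l / X j \<in> ball_pow 1 K d" if "l \<in> {1..k}" for l j
    unfolding X_def d using that uF adm nonvanishing_stable[of "?F - {u}"]
      fixed_vertex_ratio[of ?F u P l] by auto
  have GN: "l \<in> {1..k}" "\<not> bad (P u) l" if "l \<in> GN" for l
  proof -
    show "l \<in> {1..k}" using that by (simp add: GN_def)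
    have "good_colour Es W L u l \<Longrightarrow> \<not> bad_colour Es w eps W L u l"
      by (auto simp: good_colour_def bad_colour_def)
    then have "\<not> bad_colour Es w eps W L u l"
      using that by (auto simp: GN_def neutral_colour_def)
    then show "\<not> bad (P u) l"
      using L by (simp add: bad_colour_iff P_def)
  qed
  show "Zr k V Es w (W @ [u]) (L @ [l]) \<noteq> 0" if "l \<in> GN"
    using GN[OF that] X(1) by (simp add: Z pin_weight_nonzero)
  show "cangle (Zr k V Es w (W @ [u]) (L @ [l])) (Zr k V Es w (W @ [u]) (L @ [j]))
      \<le> (real d + real (D - d) * eps) * \<theta>" if l: "l \<in> GN" and j: "j \<in> GN"
  proof -
    have "cangle (Zr k V Es w (W @ [u]) (L @ [l])) (Zr k V Es w (W @ [u]) (L @ [j])) =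
        \<bar>Arg ((pin_weight (P u) l / pin_weight (P u) j) * (X l / X j))\<bar>"
      using GN l j by (simp add: cangle_def Z)
    also have "\<dots> \<le> \<bar>Arg (pin_weight (P u) l / pin_weight (P u) j)\<bar> + \<bar>Arg (X l / X j)\<bar>"
      by (rule abs_Arg_mult_le)
    also have "\<dots> \<le> real (length (P u)) * (eps * \<theta>) + real d * \<theta>"
      using abs_Arg_pin_weight_ratio_le[OF ok(1) GN(2)[OF l] GN(2)[OF j]]
        abs_Arg_ball_pow_le[OF X(2)[OF GN(1)[OF l] GN(1)[OF j]] K(1) K_bounds(1), folded theta_def]
      by (rule add_mono)
    also have "\<dots> \<le> real (D - d) * (eps * \<theta>) + real d * \<theta>"
      using ok eps theta by (intro add_right_mono mult_right_mono) auto
    finally show ?thesis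
      by (simp add: algebra_simps)
  qed
  show "Zr k V Es w (W @ [u]) (L @ [l]) / Zr k V Es w (W @ [u]) (L @ [j]) \<in> ball_pow 1 K d"
    if "l \<in> {1..k}" "j \<in> {1..k}" "good_colour Es W L u l" "good_colour Es W L u j"
  proof -
    have "pin_weight (P u) l = 1" "pin_weight (P u) j = 1"
      using that L by (auto simp: good_colour_iff P_def pin_weight_eq_1)
    then show ?thesis
      using that X(2) by (simp add: Z)
  qed
qed

end

theorem theorem3p1:
  fixes D k :: nat and eps K \<theta> :: real
    and V :: "'a set" and Es :: "'a set set" and w :: "'a set \<Rightarrow> complex"
  assumes D3: "D \<ge> 3"
    and kD: "k > D"
    and eps: "0 < eps" "eps < 1"
    and K: "0 < K" "K < 1 / (real D - 1)"
    and theta_def: "\<theta> = arcsin K"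
    and theta: "0 < \<theta>" "\<theta> < pi / (3 * (real D - 1 + eps))"
    and cond: "\<And>d. d \<le> D - 1 \<Longrightarrow>
        0 < (1 + eps)^2 / ((real k - real (D - d)) * (1 - K)^d - eps * real (D - d))
      \<and> (1 + eps)^2 / ((real k - real (D - d)) * (1 - K)^d - eps * real (D - d)) \<le> K"
    and G: "simple_graph V Es"
    and maxdeg: "max_degree_le V Es D"
    and weights: "\<And>e. e \<in> Es \<Longrightarrow>
        cmod (w e) \<le> eps \<or> (\<bar>Arg (w e)\<bar> \<le> eps * \<theta> \<and> eps < cmod (w e) \<and> cmod (w e) \<le> 1)"
  shows
    \<comment> \<open>(A)\<close>
    "(\<forall>W L. distinct W \<and> leaf_independent V Es (set W) \<and> length L = length W
        \<and> set L \<subseteq> {1..k} \<longrightarrow> Zr k V Es w W L \<noteq> 0)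
    \<and>
    \<comment> \<open>(B)\<close>
    (\<forall>W' u L' l l'. distinct (W' @ [u]) \<and> leaf_independent V Es (set (W' @ [u]))
        \<and> length L' = length W' \<and> set L' \<subseteq> {1..k} \<and> l \<in> {1..k} \<and> l' \<in> {1..k} \<longrightarrow>
        cangle (Zr k V Es w (W' @ [u]) (L' @ [l])) (Zr k V Es w (W' @ [u]) (L' @ [l'])) \<le> \<theta>
      \<and> Zr k V Es w (W' @ [u]) (L' @ [l]) / Zr k V Es w (W' @ [u]) (L' @ [l']) \<in> ball 1 K)
    \<and>
    \<comment> \<open>(C)\<close>
    (\<forall>W' u L'. distinct (W' @ [u]) \<and> u \<in> V \<and> leaf_independent V Es (set W')
        \<and> length L' = length W' \<and> set L' \<subseteq> {1..k} \<longrightarrow>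
       (let d = card {v \<in> V. adj Es u v \<and> v \<notin> set W'}; b = D - d;
            GN = {l \<in> {1..k}. good_colour Es W' L' u l \<or> neutral_colour Es w eps W' L' u l};
            Gd = {l \<in> {1..k}. good_colour Es W' L' u l}
        in (\<forall>l\<in>GN. Zr k V Es w (W' @ [u]) (L' @ [l]) \<noteq> 0)
         \<and> (\<forall>l\<in>GN. \<forall>l'\<in>GN. cangle (Zr k V Es w (W' @ [u]) (L' @ [l]))
                                    (Zr k V Es w (W' @ [u]) (L' @ [l'])) \<le> (real d + real b * eps) * \<theta>)
         \<and> (\<forall>l\<in>Gd. \<forall>j\<in>Gd. Zr k V Es w (W' @ [u]) (L' @ [l]) / Zr k V Es w (W' @ [u]) (L' @ [j])
                                \<in> ball_pow 1 K d)))"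
proof -
  interpret potts D k eps K \<theta> V Es w
    by unfold_locales (fact assms)+
  show ?thesis
  proof (intro conjI allI impI; (elim conjE)?)
    fix W L
    assume "distinct W" "leaf_independent V Es (set W)" "length L = length W" "set L \<subseteq> {1..k}"
    then show "Zr k V Es w W L \<noteq> 0"
      by (rule Zr_leaf_independent_nonzero)
  next
    fix W' u L' l l'
    assume *: "distinct (W' @ [u])" "leaf_independent V Es (set (W' @ [u]))"
      "length L' = length W'" "set L' \<subseteq> {1..k}" "l \<in> {1..k}" "l' \<in> {1..k}"
    show ball: "Zr k V Es w (W' @ [u]) (L' @ [l]) / Zr k V Es w (W' @ [u]) (L' @ [l']) \<in> ball 1 K"
      using * by (rule Zr_leaf_ratio_in_ball)
    \<comment> \<open>The angle bound (i) is a consequence of (ii), by the tangent estimate for the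
      disk about 1.\<close>
    show "cangle (Zr k V Es w (W' @ [u]) (L' @ [l])) (Zr k V Es w (W' @ [u]) (L' @ [l'])) \<le> \<theta>"
      unfolding cangle_def theta_def using ball K(1) K_bounds(1) by (rule abs_Arg_le_arcsin)
  next
    fix W' u L'
    assume *: "distinct (W' @ [u])" "u \<in> V" "leaf_independent V Es (set W')"
      "length L' = length W'" "set L' \<subseteq> {1..k}"
    show "let d = card {v \<in> V. adj Es u v \<and> v \<notin> set W'}; b = D - d;
            GN = {l \<in> {1..k}. good_colour Es W' L' u l \<or> neutral_colour Es w eps W' L' u l};
            Gd = {l \<in> {1..k}. good_colour Es W' L' u l}
        in (\<forall>l\<in>GN. Zr k V Es w (W' @ [u]) (L' @ [l]) \<noteq> 0)
         \<and> (\<forall>l\<in>GN. \<forall>l'\<in>GN. cangle (Zr k V Es w (W' @ [u]) (L' @ [l]))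
                                    (Zr k V Es w (W' @ [u]) (L' @ [l'])) \<le> (real d + real b * eps) * \<theta>)
         \<and> (\<forall>l\<in>Gd. \<forall>j\<in>Gd. Zr k V Es w (W' @ [u]) (L' @ [l]) / Zr k V Es w (W' @ [u]) (L' @ [j])
                                \<in> ball_pow 1 K d)"
      unfolding Let_def using Zr_fixed_vertex[OF *] by blast
  qed
qed

end
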